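(* Let $p$ be a prime and let $a$ be an integer with $a \not\equiv 0 \pmod p$. Then $$\left|\sum_{n=1}^{p} e^{2\pi i \frac{a n^p}{p^2}}\right| \ll p^{\frac{31}{36}} \log^{\frac16} p,$$ where the implied constant is absolute.
   Context: $\ll$ is Vinogradov's symbol: $X \ll Y$ means $|X| \le cY$ for an absolute constant $c>0$. Logarithms are to base $2$. *)

theory Defs
  imports Complex_Main "HOL-Number_Theory.Cong" "HOL-Computational_Algebra.Primes"
begin

definition heilbronn_sum :: "nat \<Rightarrow> int \<Rightarrow> complex" where
  "heilbronn_sum p a =
     (\<Sum>n = 1..p. exp (2 * of_real pi * \<i> * (of_int a * of_nat n ^ p / of_nat p ^ 2)))"

end

theory Submission
  imports Defs "HOL-Analysis.Convex" "HOL-Number_Theory.Residues" "Berlekamp_Zassenhaus.Finite_Field"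
begin

text \<open>
  Let \<open>N = p\<^sup>2\<close>, let \<open>G\<close> be the group of \<open>p\<close>-th powers of units modulo \<open>N\<close>, and let
  \<open>S = \<Sum>\<^bsub>u \<in> G\<^esub> e(a u / N)\<close>, which differs from the Heilbronn sum by 1. Bounding below the trace of
  the cube of a positive semidefinite matrix that has \<open>\<bar>S\<bar>\<^sup>2\<close> as an eigenvalue, and bounding it above by
  the Cauchy--Schwarz inequality and orthogonality, gives \<open>\<bar>S\<bar>\<^sup>6 \<le> N E\<^sub>3(G)\<close>, where \<open>E\<^sub>3(G)\<close>
  is the third moment of the number of representations as a difference of two elements of \<open>G\<close>.
  These numbers are fiber sizes of the truncated logarithm \<open>f(X) = \<Sum>\<^bsub>0 < j < p\<^esub> X\<^sup>j / j\<close> over the field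
  with \<open>p\<close> elements (Heath-Brown), and Stepanov's method bounds the size of the union of the
  fibers over a set \<open>R\<close> by a multiple of \<open>(p \<bar>R\<bar>) powr (2/3)\<close>. Hence \<open>E\<^sub>3(G)\<close> is at most a multiple of
  \<open>p\<^sup>3 log p\<close>, and the Heilbronn sum is even \<open>O(p powr (5/6) * (log p) powr (1/6))\<close>.
\<close>

section \<open>Independence of the truncated logarithm\<close>

text \<open>Truncation of -log(1 - X): in characteristic \<open>p\<close> the terms of degree below
  \<open>p\<close> are those before the first denominator that is 0.\<close>

definition trunc_log :: "'a::field poly" where
  "trunc_log = (\<Sum>j = 1..<CHAR('a). monom (inverse (of_nat j)) j)"

lemma of_nat_neq_0_below_CHAR:
  assumes "0 < n" "n < CHAR('a::field_prime_char)"
  shows "of_nat n \<noteq> (0::'a)"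
  using assms by (auto simp: of_nat_eq_0_iff_char_dvd dest: dvd_imp_le)

text \<open>The derivative is a finite geometric series. Up to the error \<open>X ^ (p - 1)\<close>
  this is the differential equation of -log(1 - X).\<close>

lemma pderiv_trunc_log:
  "[:1, -1:] * pderiv (trunc_log :: 'a::field_prime_char poly) = 1 - [:0, 1:] ^ (CHAR('a) - 1)"
proof -
  have *: "pderiv (monom (inverse (of_nat j)) j :: 'a poly) = [:0, 1:] ^ (j - 1)"
    if "j \<in> {1..<CHAR('a)}" for j
    using that of_nat_neq_0_below_CHAR[of j, where 'a = 'a] by (simp add: pderiv_monom) (simp add: monom_altdef)
  have "pderiv (trunc_log :: 'a poly) = (\<Sum>j = 1..<CHAR('a). [:0, 1:] ^ (j - 1))"
    unfolding trunc_log_def using * by (simp add: pderiv_sum)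
  also have "\<dots> = (\<Sum>i < CHAR('a) - 1. [:0, 1:] ^ i)"
    by (rule sum.reindex_bij_witness[of _ Suc "\<lambda>j. j - 1"]) auto
  finally have d: "pderiv (trunc_log :: 'a poly) = (\<Sum>i < CHAR('a) - 1. [:0, 1:] ^ i)" .
  have "[:1, -1:] = (1 - [:0, 1:] :: 'a poly)" by (simp add: one_pCons)
  with d show ?thesis by (simp add: one_diff_power_eq)
qed

lemma degree_trunc_log: "degree (trunc_log :: 'a::field_prime_char poly) \<le> CHAR('a) - 1"
  unfolding trunc_log_def
  by (intro degree_sum_le) (auto intro!: order.trans[OF degree_monom_le])

lemma power_X_dvd_derivation:
  fixes G :: "'a::field poly"
  assumes "[:0, 1:] ^ Suc n dvd G"
  shows "[:0, 1:] ^ n dvd [:1, -1:] * pderiv G + smult c G"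
proof -
  from assms obtain H where G: "G = [:0, 1:] ^ Suc n * H" by (elim dvdE)
  have "[:0, 1:] ^ n dvd pderiv G"
    unfolding G pderiv_mult pderiv_power_Suc
    by (intro dvd_add) (auto simp: pderiv_pCons intro: dvd_mult dvd_mult2 dvd_smult simp del: power_Suc
       intro!: dvd_mult2[OF le_imp_power_dvd])
  moreover have "[:0, 1:] ^ n dvd G"
    using assms by (rule power_le_dvd) simp
  ultimately show ?thesis by (intro dvd_add dvd_mult dvd_smult)
qed

text \<open>The operator (1 - X) d/dX multiplies \<open>(1 - X) ^ a\<close> by \<open>- a\<close>
  and sends \<open>L\<close> to \<open>1 - X ^ (p - 1)\<close>; the product and chain rules do the
  rest.\<close>

lemma pderiv_power_mult_pcompose_trunc_log:
  fixes F :: "'a::field_prime_char poly"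
  defines "L \<equiv> trunc_log :: 'a poly"
  shows "[:1, -1:] * pderiv ([:1, -1:] ^ a * pcompose F L) =
    [:1, -1:] ^ a * pcompose (pderiv F - smult (of_nat a) F) L
     - [:0, 1:] ^ (CHAR('a) - 1) * ([:1, -1:] ^ a * pcompose (pderiv F) L)"
proof -
  have 1: "[:1, -1:] * pderiv ([:1, -1:] ^ a :: 'a poly) = - of_nat a * [:1, -1:] ^ a"
    by (cases a) (simp_all add: pderiv_power_Suc pderiv_pCons of_nat_poly del: power_Suc of_nat_Suc, simp_all add: algebra_simps)
  have "[:1, -1:] * pderiv ([:1, -1:] ^ a * pcompose F L) =
      [:1, -1:] ^ a * pcompose (pderiv F) L * ([:1, -1:] * pderiv L)
      + ([:1, -1:] * pderiv ([:1, -1:] ^ a)) * pcompose F L"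
    by (simp only: pderiv_mult pderiv_pcompose) (simp only: algebra_simps)
  also have "[:1, -1:] * pderiv L = 1 - [:0, 1:] ^ (CHAR('a) - 1)"
    unfolding L_def by (rule pderiv_trunc_log)
  finally show ?thesis unfolding 1
    by (simp only: pcompose_diff pcompose_smult of_nat_poly) (simp add: algebra_simps)
qed

text \<open>Modulo \<open>X ^ (p - 1)\<close>, the operator \<open>(1 - X) d/dX + a\<^sub>0\<close> maps sums of this shape to sums of the same
  shape. It lowers the degree of the coefficient \<open>F a\<^sub>0\<close>, does not raise the others, and costs one power of \<open>X\<close>.\<close>

lemma trunc_log_independent:
  fixes F :: "nat \<Rightarrow> 'a::field_prime_char poly"
  assumes "finite S" "S \<subseteq> {..<CHAR('a)}"
    and "\<And>a. a \<in> S \<Longrightarrow> F a \<noteq> 0 \<and> degree (F a) < CHAR('a)"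
    and "(\<Sum>a\<in>S. Suc (degree (F a))) \<le> n" "n \<le> CHAR('a)"
    and "[:0, 1:] ^ n dvd (\<Sum>a\<in>S. [:1, -1:] ^ a * pcompose (F a) trunc_log)"
  shows "S = {}"
  using assms
proof (induction n arbitrary: S F)
  case 0
  then show ?case by auto
next
  case (Suc n)
  show ?case
  proof (rule ccontr)
    assume "S \<noteq> {}"
    then obtain a0 where a0: "a0 \<in> S" by blast
    define L :: "'a poly" where "L = trunc_log"
    define G where "G = (\<Sum>a\<in>S. [:1, -1:] ^ a * pcompose (F a) L)"
    define F' where "F' a = smult (of_nat a0 - of_nat a) (F a) + pderiv (F a)" for a
    have sm: "F' a = pderiv (F a) - smult (of_nat a) (F a) + smult (of_nat a0) (F a)" for a
      by (simp add: F'_def smult_diff_left)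
    have "[:1, -1:] * pderiv G + smult (of_nat a0) G =
       (\<Sum>a\<in>S. [:1, -1:] * pderiv ([:1, -1:] ^ a * pcompose (F a) L)
           + [:1, -1:] ^ a * pcompose (smult (of_nat a0) (F a)) L)"
      unfolding G_def pderiv_sum smult_sum2 sum_distrib_left sum.distrib
      by (simp add: pcompose_smult)
    also have "\<dots> = (\<Sum>a\<in>S. [:1, -1:] ^ a * pcompose (F' a) L
           - [:0, 1:] ^ (CHAR('a) - 1) * ([:1, -1:] ^ a * pcompose (pderiv (F a)) L))"
      unfolding L_def pderiv_power_mult_pcompose_trunc_log sm pcompose_add
      by (intro sum.cong) (simp_all add: algebra_simps)
    finally have eq: "(\<Sum>a\<in>S. [:1, -1:] ^ a * pcompose (F' a) L) =
       ([:1, -1:] * pderiv G + smult (of_nat a0) G)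
        + (\<Sum>a\<in>S. [:0, 1:] ^ (CHAR('a) - 1) * ([:1, -1:] ^ a * pcompose (pderiv (F a)) L))"
      by (simp add: sum_subtractf)
    have "[:0, 1:] ^ Suc n dvd G" using Suc.prems(6) unfolding G_def L_def .
    \<comment> \<open>\<open>Suc n \<le> CHAR('a)\<close> makes the error terms, multiples of
      \<open>X ^ (p - 1)\<close>, divisible by \<open>X ^ n\<close>.\<close>
    then have "[:0, 1:] ^ n dvd (\<Sum>a\<in>S. [:1, -1:] ^ a * pcompose (F' a) L)"
      unfolding eq using Suc.prems(5)
      by (intro dvd_add power_X_dvd_derivation dvd_sum dvd_mult2 le_imp_power_dvd) auto
    also have "(\<Sum>a\<in>S. [:1, -1:] ^ a * pcompose (F' a) L)
        = (\<Sum>a\<in>{a\<in>S. F' a \<noteq> 0}. [:1, -1:] ^ a * pcompose (F' a) L)"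
      by (rule sum.mono_neutral_right) (use Suc.prems in auto)
    finally have dvd': "[:0, 1:] ^ n dvd \<dots>" .
    have deg_le: "degree (F' a) \<le> degree (F a)" for a
      unfolding F'_def by (intro degree_add_le) (auto intro: order.trans[OF degree_pderiv_le])
    have deg_a0: "F' a0 = 0 \<or> degree (F' a0) < degree (F a0)"
    proof (cases "degree (F a0) = 0")
      case True
      then have "F' a0 = 0" by (auto simp: F'_def elim!: degree_eq_zeroE)
      then show ?thesis ..
    next
      case False
      then show ?thesis using degree_pderiv_le[of "F a0"] by (auto simp: F'_def)
    qed
    \<comment> \<open>Distinct exponents below the characteristic stay distinct in the field, so the
      leading coefficient is only multiplied by a nonzero factor.\<close>
    have nz: "F' a \<noteq> 0" if "a \<in> S" "a \<noteq> a0" for a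
    proof -
      have "of_nat a0 \<noteq> (of_nat a :: 'a)"
        using that a0 Suc.prems(2) by (auto simp: of_nat_eq_iff_cong_CHAR dest: cong_less_modulus_unique_nat)
      moreover have "coeff (F' a) (degree (F a)) = (of_nat a0 - of_nat a) * lead_coeff (F a)"
        by (simp add: F'_def coeff_pderiv coeff_eq_0)
      ultimately have "coeff (F' a) (degree (F a)) \<noteq> 0"
        using Suc.prems(3)[OF that(1)] by simp
      then show ?thesis by auto
    qed
    have "(\<Sum>a\<in>{a\<in>S. F' a \<noteq> 0}. Suc (degree (F' a))) =
        (\<Sum>a\<in>S. if F' a \<noteq> 0 then Suc (degree (F' a)) else 0)"
      using Suc.prems(1) by (simp add: sum.inter_filter)
    also have "\<dots> < (\<Sum>a\<in>S. Suc (degree (F a)))"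
    proof (rule sum_strict_mono_ex1)
      show "\<exists>a\<in>S. (if F' a \<noteq> 0 then Suc (degree (F' a)) else 0) < Suc (degree (F a))"
        using a0 deg_a0 by (intro bexI[of _ a0]) auto
    qed (use Suc.prems(1) deg_le in auto)
    finally have meas: "(\<Sum>a\<in>{a\<in>S. F' a \<noteq> 0}. Suc (degree (F' a))) < (\<Sum>a\<in>S. Suc (degree (F a)))" .
    have "{a\<in>S. F' a \<noteq> 0} = {}"
    proof (rule Suc.IH[of _ F'])
      show "F' a \<noteq> 0 \<and> degree (F' a) < CHAR('a)" if "a \<in> {a\<in>S. F' a \<noteq> 0}" for a
        using that Suc.prems(3)[of a] deg_le[of a] by auto
    qed (use Suc.prems(1,2,4,5) meas dvd' in \<open>auto simp: L_def\<close>)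
    then have S: "S = {a0}" and F'0: "F' a0 = 0" using nz a0 by blast+
    \<comment> \<open>\<open>F' a0\<close> is the derivative of \<open>F a0\<close>. A degree
      strictly between 0 and the characteristic would leave it a nonzero leading
      coefficient.\<close>
    have "degree (F a0) = 0"
    proof (rule ccontr)
      assume d: "degree (F a0) \<noteq> 0"
      then have "coeff (pderiv (F a0)) (degree (F a0) - 1) = of_nat (degree (F a0)) * lead_coeff (F a0)"
        by (simp add: coeff_pderiv)
      also have "\<dots> \<noteq> 0"
        using d Suc.prems(3)[OF a0] of_nat_neq_0_below_CHAR[of "degree (F a0)", where 'a = 'a] by auto
      finally show False using F'0 by (auto simp: F'_def)
    qed
    then obtain c where c: "F a0 = [:c:]" by (elim degree_eq_zeroE)
    have "[:0, 1:] dvd G"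
      using \<open>[:0, 1:] ^ Suc n dvd G\<close> by (rule dvd_trans[OF dvd_power, rotated]) simp
    then have "poly G 0 = 0" by (auto elim!: dvdE)
    then have "c = 0" by (simp add: G_def S c)
    then show False using Suc.prems(3)[OF a0] c by simp
  qed
qed

section \<open>Stepanov's method\<close>

text \<open>With the factor X (1 - X), the ring generated by 1 - X, \<open>trunc_log\<close> and
  \<open>X ^ p\<close> is closed under the derivation. The factor is nonzero at every point other
  than 0 and 1.\<close>

definition log_derivation :: "'a::field poly \<Rightarrow> 'a poly" where
  "log_derivation G = [:0, 1, -1:] * pderiv G"

lemma log_derivation_mult:
  "log_derivation (G * H) = log_derivation G * H + G * log_derivation H"
  unfolding log_derivation_def pderiv_mult by (simp only: algebra_simps)

lemma log_derivation_power:
  "log_derivation (G ^ n) = of_nat n * G ^ (n - 1) * log_derivation G"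
proof -
  have "smult (of_nat n) K = of_nat n * K" for K :: "'a poly" by (simp add: of_nat_poly)
  then show ?thesis by (simp only: log_derivation_def pderiv_power mult_ac)
qed

lemma log_derivation_add: "log_derivation (G + H) = log_derivation G + log_derivation H"
  by (simp only: log_derivation_def pderiv_add distrib_left)

lemma log_derivation_smult: "log_derivation (smult c G) = smult c (log_derivation G)"
  by (simp only: log_derivation_def pderiv_smult mult_smult_right)

lemma funpow_log_derivation_add:
  "(log_derivation ^^ n) (G + H) = (log_derivation ^^ n) G + (log_derivation ^^ n) H"
  by (induction n) (simp_all add: log_derivation_add)

lemma funpow_log_derivation_smult:
  "(log_derivation ^^ n) (smult c G) = smult c ((log_derivation ^^ n) G)"
  by (induction n) (simp_all add: log_derivation_smult)

lemma funpow_log_derivation_diff: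
  "(log_derivation ^^ n) (G - H) = (log_derivation ^^ n) G - (log_derivation ^^ n) H"
  using funpow_log_derivation_add[of n G "smult (-1) H"] funpow_log_derivation_smult[of n "-1" H] by simp

lemma funpow_log_derivation_sum:
  "(log_derivation ^^ n) (sum g I) = (\<Sum>i\<in>I. (log_derivation ^^ n) (g i))"
proof (induction I rule: infinite_finite_induct)
  case (insert i I)
  then show ?case by (simp add: funpow_log_derivation_add)
qed (use funpow_log_derivation_smult[of n 0] in simp_all)

text \<open>Away from 0 and 1 this derivation detects orders of vanishing as the ordinary one does.
  The order is limited by the characteristic, since each induction step divides by the current
  multiplicity.\<close>

lemma linear_power_dvd_if_log_derivations_vanish:
  fixes G :: "'a::field_prime_char poly"
  assumes "x \<noteq> 0" "x \<noteq> 1" "m \<le> CHAR('a)"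
    and "\<And>n. n < m \<Longrightarrow> poly ((log_derivation ^^ n) G) x = 0"
  shows "[:-x, 1:] ^ m dvd G"
  using assms(3,4)
proof (induction m arbitrary: G)
  case (Suc m)
  show ?case
  proof (cases "m = 0")
    case True
    then show ?thesis using Suc.prems(2)[of 0] by (simp add: poly_eq_0_iff_dvd)
  next
    case False
    define Y where "Y = [:-x, 1:]"
    have "Y ^ m dvd G" unfolding Y_def
      by (rule Suc.IH) (use Suc.prems in auto)
    then obtain H where H: "G = Y ^ m * H" by (elim dvdE)
    have "Y ^ m dvd log_derivation G" unfolding Y_def
    proof (rule Suc.IH)
      show "poly ((log_derivation ^^ n) (log_derivation G)) x = 0" if "n < m" for n
        using Suc.prems(2)[of "Suc n"] that by (simp add: funpow_swap1)
    qed (use Suc.prems in auto)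
    have dY: "log_derivation Y = [:0, 1, -1:]" by (simp add: log_derivation_def Y_def pderiv_pCons)
    \<comment> \<open>The product rule leaves \<open>m * Y ^ (m - 1) * X (1 - X) * H\<close>. As
      \<open>m\<close>, \<open>x\<close> and \<open>1 - x\<close> are nonzero, one more factor
      \<open>Y\<close> must come from \<open>H\<close>.\<close>
    from \<open>Y ^ m dvd log_derivation G\<close> have "Y ^ m dvd log_derivation G - Y ^ m * log_derivation H" by simp
    also have "log_derivation G - Y ^ m * log_derivation H = Y ^ (m - 1) * (of_nat m * [:0, 1, -1:] * H)"
      unfolding H log_derivation_mult log_derivation_power dY by (simp only: algebra_simps)
    finally have "Y ^ (m - 1) * Y dvd Y ^ (m - 1) * (of_nat m * [:0, 1, -1:] * H)"
      using False by (cases m) (simp_all only: power_Suc2 diff_Suc_1)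
    moreover have "Y ^ (m - 1) \<noteq> 0" by (simp add: Y_def)
    ultimately have "Y dvd of_nat m * [:0, 1, -1:] * H" by (simp only: dvd_mult_cancel_left simp_thms)
    then have "poly (of_nat m * [:0, 1, -1:] * H) x = 0"
      unfolding Y_def by (simp only: poly_eq_0_iff_dvd)
    moreover have "of_nat m \<noteq> (0 :: 'a)"
      using of_nat_neq_0_below_CHAR[of m, where 'a = 'a] False Suc.prems(1) by simp
    moreover have "poly [:0, 1, -1:] x = x * (1 - x)" by simp
    ultimately have "poly H x = 0" using assms(1,2) by (simp only: poly_mult poly_of_nat) auto
    then have "Y dvd H" unfolding Y_def by (simp only: poly_eq_0_iff_dvd)
    then show ?thesis unfolding H Y_def[symmetric] by (simp add: mult_dvd_mono mult.commute)
  qed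
qed simp

text \<open>On a fiber of \<open>trunc_log\<close> in the prime field, \<open>X ^ p\<close> agrees
  with X and \<open>trunc_log\<close> is constant. Hence many independent monomials collapse there
  to polynomials of low degree, so few linear conditions force vanishing.\<close>

definition stepanov_monom :: "nat \<Rightarrow> nat \<Rightarrow> nat \<Rightarrow> 'a::field poly" where
  "stepanov_monom a b c = [:1, -1:] ^ a * trunc_log ^ b * ([:0, 1:] ^ CHAR('a)) ^ c"

lemma log_derivation_trunc_log:
  "log_derivation (trunc_log :: 'a::field_prime_char poly) = [:0, 1:] - [:0, 1:] ^ CHAR('a)"
proof -
  have "[:0, 1, -1:] = [:0, 1:] * [:1, -1 :: 'a:]" by simp
  then have "log_derivation (trunc_log :: 'a poly) = [:0, 1:] * (1 - [:0, 1:] ^ (CHAR('a) - 1))"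
    unfolding log_derivation_def using pderiv_trunc_log[where 'a = 'a] by (simp only: mult.assoc)
  also have "\<dots> = [:0, 1:] - [:0, 1:] * [:0, 1:] ^ (CHAR('a) - 1)"
    by (simp only: right_diff_distrib mult_1_right)
  also have "[:0, 1:] * [:0, 1:] ^ (CHAR('a) - 1) = ([:0, 1:] ^ CHAR('a) :: 'a poly)"
    by (simp only: power_Suc[symmetric]) simp
  finally show ?thesis .
qed

text \<open>Product rule with \<open>U \<mapsto> U ^ 2 - U\<close>,
  \<open>L \<mapsto> 1 - U - Z\<close> and \<open>Z \<mapsto> 0\<close>. For \<open>b = 0\<close>
  the truncated \<open>b - 1\<close> is harmless, because its coefficient is 0.\<close>

lemma log_derivation_stepanov_monom:
  "log_derivation (stepanov_monom a b c :: 'a::field_prime_char poly) =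
     smult (of_nat a) (stepanov_monom (Suc a) b c - stepanov_monom a b c)
     + smult (of_nat b) (stepanov_monom a (b - 1) c - stepanov_monom (Suc a) (b - 1) c
          - stepanov_monom a (b - 1) (Suc c))"
proof -
  define U Z L where "U = [:1, -1 :: 'a:]" and "Z = [:0, 1 :: 'a:] ^ CHAR('a)" and "L = (trunc_log :: 'a poly)"
  have X: "[:0, 1 :: 'a:] = 1 - U" by (simp add: U_def one_pCons)
  have dU: "log_derivation U = U ^ 2 - U"
    by (simp add: log_derivation_def U_def pderiv_pCons power2_eq_square)
  have dL: "log_derivation L = 1 - U - Z"
    unfolding L_def Z_def log_derivation_trunc_log X ..
  have dZ: "log_derivation Z = 0"
    unfolding Z_def log_derivation_power by (simp add: of_nat_eq_0_iff_char_dvd)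
  have U1: "of_nat a * U ^ (a - 1) * (U ^ 2 - U) = of_nat a * (U ^ Suc a - U ^ a)"
    by (cases a) (simp_all add: algebra_simps power2_eq_square)
  have "log_derivation (stepanov_monom a b c) =
      (of_nat a * U ^ (a - 1) * (U ^ 2 - U)) * L ^ b * Z ^ c + U ^ a * (of_nat b * L ^ (b - 1) * (1 - U - Z)) * Z ^ c"
    unfolding stepanov_monom_def U_def[symmetric] L_def[symmetric] Z_def[symmetric]
      log_derivation_mult log_derivation_power dU dL dZ by (simp add: algebra_simps)
  also have "\<dots> = of_nat a * (stepanov_monom (Suc a) b c - stepanov_monom a b c)
     + of_nat b * (stepanov_monom a (b - 1) c - stepanov_monom (Suc a) (b - 1) c
          - stepanov_monom a (b - 1) (Suc c))"
    unfolding U1 stepanov_monom_def U_def[symmetric] L_def[symmetric] Z_def[symmetric]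
    by (simp add: algebra_simps)
  finally show ?thesis by (simp add: of_nat_poly)
qed

text \<open>At a point \<open>x\<close> with \<open>x ^ p = x\<close> and \<open>f(x) = r\<close>, iterated derivatives of the monomials
  are values of polynomials in \<open>x\<close> of low degree.\<close>

fun reduced_derivative :: "'a::field \<Rightarrow> nat \<Rightarrow> nat \<Rightarrow> nat \<Rightarrow> nat \<Rightarrow> 'a poly" where
  "reduced_derivative r 0 a b c = smult (r ^ b) ([:1, -1:] ^ a * [:0, 1:] ^ c)"
| "reduced_derivative r (Suc n) a b c =
     smult (of_nat a) (reduced_derivative r n (Suc a) b c - reduced_derivative r n a b c)
     + smult (of_nat b) (reduced_derivative r n a (b - 1) c - reduced_derivative r n (Suc a) (b - 1) c
          - reduced_derivative r n a (b - 1) (Suc c))"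

text \<open>Each step of the recursion raises \<open>a + c\<close> by at most one.\<close>

lemma degree_reduced_derivative: "degree (reduced_derivative r n a b c) \<le> a + c + n"
proof (induction n arbitrary: a b c)
  case 0
  have "degree ([:1, -1:] ^ a * [:0, 1 :: 'a:] ^ c) \<le> a + c"
    by (intro order.trans[OF degree_mult_le] add_mono order.trans[OF degree_power_le]) auto
  then show ?case by (auto intro: order.trans[OF degree_smult_le])
next
  case (Suc n)
  have "degree (reduced_derivative r n a' b' c') \<le> a + c + Suc n" if "a' + c' \<le> Suc (a + c)" for a' b' c'
    using Suc.IH[of a' b' c'] that by simp
  then show ?case
    by (auto intro!: degree_add_le degree_diff_le order.trans[OF degree_smult_le])
qed

lemma poly_funpow_log_derivation_stepanov_monom:
  fixes x :: "'a::field_prime_char"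
  assumes "x ^ CHAR('a) = x" "poly trunc_log x = r"
  shows "poly ((log_derivation ^^ n) (stepanov_monom a b c)) x = poly (reduced_derivative r n a b c) x"
proof (induction n arbitrary: a b c)
  case 0
  show ?case using assms by (simp add: stepanov_monom_def)
next
  case (Suc n)
  show ?case
    unfolding funpow_Suc_right o_apply log_derivation_stepanov_monom
    by (simp add: funpow_log_derivation_add funpow_log_derivation_smult funpow_log_derivation_diff Suc)
qed

section \<open>Existence and nonvanishing of the auxiliary polynomial\<close>

lemma ex_nontrivial_solution:
  fixes M :: "'j \<Rightarrow> 'i \<Rightarrow> 'a::{comm_ring_1, finite}"
  assumes "finite I" "finite J" "card J < card I"
  shows "\<exists>v. (\<exists>i\<in>I. v i \<noteq> 0) \<and> (\<forall>j\<in>J. (\<Sum>i\<in>I. v i * M j i) = 0)"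
proof -
  \<comment> \<open>\<open>h\<close> sends the unknowns to the left-hand sides of the equations.
    With fewer equations than unknowns it has a collision by counting, and the difference of the
    colliding vectors is a solution.\<close>
  define h where "h v = restrict (\<lambda>j. \<Sum>i\<in>I. v i * M j i) J" for v
  have "card (h ` (I \<rightarrow>\<^sub>E UNIV)) \<le> card (J \<rightarrow>\<^sub>E (UNIV :: 'a set))"
    using assms by (intro card_mono finite_PiE) (auto simp: h_def)
  also have "\<dots> = CARD('a) ^ card J" using assms by (simp add: card_PiE)
  also have "\<dots> < CARD('a) ^ card I"
  proof -
    have "card {0, 1 :: 'a} \<le> CARD('a)" by (intro card_mono) auto
    then show ?thesis using assms by (intro power_strict_increasing) auto
  qed
  also have "\<dots> = card (I \<rightarrow>\<^sub>E (UNIV :: 'a set))" using assms by (simp add: card_PiE)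
  finally have "\<not> inj_on h (I \<rightarrow>\<^sub>E UNIV)" by (rule pigeonhole)
  then obtain u v where uv: "u \<in> I \<rightarrow>\<^sub>E UNIV" "v \<in> I \<rightarrow>\<^sub>E UNIV" "u \<noteq> v" "h u = h v"
    by (auto simp: inj_on_def)
  then have "\<exists>i\<in>I. u i - v i \<noteq> 0" by (metis PiE_ext right_minus_eq)
  moreover have "(\<Sum>i\<in>I. (u i - v i) * M j i) = 0" if "j \<in> J" for j
    using fun_cong[OF uv(4), of j] that by (simp add: h_def left_diff_distrib sum_subtractf)
  ultimately show ?thesis by (intro exI[of _ "\<lambda>i. u i - v i"]) auto
qed

text \<open>In a vanishing combination, the lowest power of \<open>Z = X ^ p\<close> with a nonzero
  coefficient polynomial can be cancelled. That coefficient is then divisible by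
  \<open>X ^ p\<close>, against \<open>trunc_log_independent\<close>.\<close>

lemma stepanov_monom_independent:
  fixes v :: "nat \<times> nat \<times> nat \<Rightarrow> 'a::field_prime_char"
  assumes AB: "A * B \<le> CHAR('a)" 
    and zero: "(\<Sum>(c, a, b)\<in>{..<C} \<times> {..<A} \<times> {..<B}. smult (v (c, a, b)) (stepanov_monom a b c)) = 0"
    and "i \<in> {..<C} \<times> {..<A} \<times> {..<B}"
  shows "v i = 0"
proof (rule ccontr)
  assume "v i \<noteq> 0"
  with assms(3) obtain c1 a1 b1 where i: "c1 < C" "a1 < A" "b1 < B" "v (c1, a1, b1) \<noteq> 0" by auto
  define F where "F c a = (\<Sum>b<B. monom (v (c, a, b)) b)" for c a
  have coeff_F: "coeff (F c a) b = v (c, a, b)" if "b < B" for a b c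
    using that by (simp add: F_def coeff_sum)
  have deg_F: "degree (F c a) < B" for a c
    using i by (auto simp: F_def intro!: degree_sum_less le_less_trans[OF degree_monom_le])
  define G where "G c = (\<Sum>a<A. [:1, -1:] ^ a * pcompose (F c a) trunc_log)" for c
  define Z where "Z = [:0, 1 :: 'a:] ^ CHAR('a)"
  define c0 where "c0 = (LEAST c. \<exists>a<A. F c a \<noteq> 0)"
  have "\<exists>a<A. F c1 a \<noteq> 0" using i coeff_F[of b1 c1 a1] by (intro exI[of _ a1]) auto
  then have c0: "\<exists>a<A. F c0 a \<noteq> 0" "c0 \<le> c1" unfolding c0_def
    by (rule LeastI, rule Least_le)
  have below: "G c = 0" if "c < c0" for c
    using not_less_Least[OF that[unfolded c0_def]] by (simp add: G_def)
  have "0 = (\<Sum>c<C. \<Sum>a<A. \<Sum>b<B. smult (v (c, a, b)) (stepanov_monom a b c))"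
    using zero by (simp add: sum.cartesian_product)
  also have "\<dots> = (\<Sum>c<C. Z ^ c * G c)"
    by (simp add: G_def F_def Z_def stepanov_monom_def pcompose_sum sum_distrib_left monom_altdef
         pcompose_smult pcompose_hom.hom_power pcompose_pCons mult_ac)
  also have "\<dots> = (\<Sum>c\<in>{c0..<C}. Z ^ c * G c)"
    by (rule sum.mono_neutral_right) (auto simp: below not_le)
  also have "\<dots> = Z ^ c0 * G c0 + (\<Sum>c\<in>{Suc c0..<C}. Z ^ c * G c)"
    using c0(2) i(1) by (simp add: sum.atLeast_Suc_lessThan)
  finally have "Z ^ c0 * G c0 = - (\<Sum>c\<in>{Suc c0..<C}. Z ^ c * G c)" by (simp add: eq_neg_iff_add_eq_0)
  moreover have "Z ^ c0 * Z dvd (\<Sum>c\<in>{Suc c0..<C}. Z ^ c * G c)"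
    unfolding power_Suc2[symmetric] by (intro dvd_sum dvd_mult2 le_imp_power_dvd) auto
  ultimately have "Z ^ c0 * Z dvd Z ^ c0 * G c0" by simp
  then have "Z dvd G c0" by (simp add: Z_def)
  also have "G c0 = (\<Sum>a\<in>{a\<in>{..<A}. F c0 a \<noteq> 0}. [:1, -1:] ^ a * pcompose (F c0 a) trunc_log)"
    unfolding G_def by (rule sum.mono_neutral_right) auto
  finally have dvd: "[:0, 1:] ^ CHAR('a) dvd \<dots>" unfolding Z_def .
  have "A * 1 \<le> A * B" "1 * B \<le> A * B" using i by (intro mult_le_mono; simp)+
  then have le: "A \<le> CHAR('a)" "B \<le> CHAR('a)" using AB by linarith+
  \<comment> \<open>At most \<open>A\<close> polynomials of degree below \<open>B\<close>: the
    measure is at most \<open>A * B\<close>, within the allowed \<open>CHAR('a)\<close>.\<close>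
  have "(\<Sum>a\<in>{a\<in>{..<A}. F c0 a \<noteq> 0}. Suc (degree (F c0 a))) \<le> (\<Sum>a<A. B)"
    using deg_F by (intro sum_le_included[where i = "\<lambda>x. x"]) (auto simp: Suc_le_eq)
  with AB have "(\<Sum>a\<in>{a\<in>{..<A}. F c0 a \<noteq> 0}. Suc (degree (F c0 a))) \<le> CHAR('a)" by simp
  then have "{a\<in>{..<A}. F c0 a \<noteq> 0} = {}"
    using le dvd deg_F
    by (intro trunc_log_independent[where F = "F c0" and n = "CHAR('a)"]) (auto intro: less_le_trans)
  with c0(1) show False by blast
qed

lemma sum_order_le_degree:
  assumes "G \<noteq> 0" "finite M"
  shows "(\<Sum>x\<in>M. order x G) \<le> degree (G :: 'a::idom poly)"
proof -
  have "(\<Sum>x\<in>M. order x G) \<le> (\<Sum>x\<in>M \<union> set_mset (proots G). order x G)"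
    using assms by (intro sum_mono2) (auto simp: poly_roots_finite)
  also have "\<dots> = (\<Sum>x\<in>set_mset (proots G). count (proots G) x)"
    using assms by (intro sum.mono_neutral_cong_right finite_UnI finite_set_mset) (auto simp: order_root)
  also have "\<dots> \<le> degree G" using size_proots_le[of G] by (simp add: size_multiset_overloaded_eq)
  finally show ?thesis .
qed

text \<open>A nonzero combination of Stepanov monomials is made to vanish to order \<open>A\<close>
  at every point counted. Hence \<open>A\<close> times the number of points is at most its
  degree.\<close>

theorem card_trunc_log_preimage_le:
  fixes R :: "'a::finite_field set"
  assumes b: "b ^ 2 \<le> CHAR('a)" "3 * card R * CHAR('a) < b ^ 3"
  shows "card {x. x ^ CHAR('a) = x \<and> x \<noteq> 0 \<and> x \<noteq> 1 \<and> poly trunc_log x \<in> R} \<le> 4 * b ^ 2"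
proof -
  define p where "p = CHAR('a)"
  define M where "M = {x :: 'a. x ^ p = x \<and> x \<noteq> 0 \<and> x \<noteq> 1 \<and> poly trunc_log x \<in> R}"
  have "b > 0" using b(2) by (cases b) auto
  \<comment> \<open>The largest \<open>A\<close> with \<open>A * b \<le> p\<close>, as independence
    of the monomials requires. Large \<open>A\<close> means a high order of vanishing.\<close>
  define A where "A = p div b"
  have Ab: "A * b \<le> p" by (simp add: A_def)
  have bA: "b \<le> A" using b(1) \<open>b > 0\<close> by (simp add: A_def p_def less_eq_div_iff_mult_less_eq power2_eq_square)
  have "b * (3 * card R * A) \<le> 3 * card R * p" using Ab by (simp add: mult_ac)
  also have "\<dots> < b * b ^ 2" using b(2) by (simp add: p_def power3_eq_cube power2_eq_square)
  finally have RA: "3 * card R * A < b ^ 2" by simp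
  define I where "I = {..<b} \<times> {..<A} \<times> {..<b}"
  \<comment> \<open>One equation for each value \<open>r\<close>, each order \<open>n < A\<close>
    and each coefficient: reduced derivatives have degree at most
    \<open>a + c + n < A + b + A\<close>. With \<open>b \<le> A\<close> there are at most
    \<open>3 * card R * A ^ 2\<close> equations for \<open>A * b ^ 2\<close> unknowns.\<close>
  define J where "J = R \<times> {..<A} \<times> {..<A + b + A}"
  have "card J = card R * (A * (A + b + A))" by (simp add: J_def card_cartesian_product)
  also have "\<dots> \<le> card R * (A * (3 * A))" using bA by (intro mult_le_mono) auto
  also have "\<dots> = A * (3 * card R * A)" by simp
  also have "\<dots> < A * b ^ 2" using RA bA \<open>b > 0\<close> by simp
  also have "\<dots> = card I" by (simp add: I_def card_cartesian_product power2_eq_square)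
  finally have "\<exists>v. (\<exists>i\<in>I. v i \<noteq> 0) \<and> (\<forall>j\<in>J. (\<Sum>i\<in>I. v i *
      (case (j, i) of ((r, n, k), (c, a, \<beta>)) \<Rightarrow> coeff (reduced_derivative r n a \<beta> c) k)) = 0)"
    by (intro ex_nontrivial_solution) (auto simp: I_def J_def)
  then obtain v where v: "\<exists>i\<in>I. v i \<noteq> 0" and vJ: "\<forall>j\<in>J. (\<Sum>i\<in>I. v i *
      (case (j, i) of ((r, n, k), (c, a, \<beta>)) \<Rightarrow> coeff (reduced_derivative r n a \<beta> c) k)) = 0"
    by (elim exE conjE)
  have veq: "(\<Sum>(c, a, \<beta>)\<in>I. v (c, a, \<beta>) * coeff (reduced_derivative r n a \<beta> c) k) = 0"
    if "r \<in> R" "n < A" "k < A + b + A" for r n k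
  proof -
    have "(r, n, k) \<in> J" using that by (simp add: J_def)
    from bspec[OF vJ this] show ?thesis by (simp add: case_prod_unfold)
  qed
  define G where "G = (\<Sum>(c, a, \<beta>)\<in>I. smult (v (c, a, \<beta>)) (stepanov_monom a \<beta> c))"
  have "G \<noteq> 0"
  proof
    assume "G = 0"
    then have "v i = 0" if "i \<in> I" for i
      using that Ab unfolding G_def I_def p_def by (intro stepanov_monom_independent[where v = v])
    with v show False by blast
  qed
  have red0: "(\<Sum>(c, a, \<beta>)\<in>I. smult (v (c, a, \<beta>)) (reduced_derivative r n a \<beta> c)) = 0"
    if "r \<in> R" "n < A" for r n
  proof (rule poly_eqI)
    fix k
    have "(\<Sum>(c, a, \<beta>)\<in>I. v (c, a, \<beta>) * coeff (reduced_derivative r n a \<beta> c) k) = 0"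
    proof (cases "k < A + b + A")
      case True
      show ?thesis by (rule veq[OF that True])
    next
      case False
      have "coeff (reduced_derivative r n a \<beta> c) k = 0" if "(c, a, \<beta>) \<in> I" for a \<beta> c
        using that False \<open>n < A\<close> degree_reduced_derivative[of r n a \<beta> c]
        by (intro coeff_eq_0) (auto simp: I_def)
      then show ?thesis by (intro sum.neutral) auto
    qed
    then show "coeff (\<Sum>(c, a, \<beta>)\<in>I. smult (v (c, a, \<beta>)) (reduced_derivative r n a \<beta> c)) k = coeff 0 k"
      by (simp add: coeff_sum case_prod_unfold)
  qed
  have "A \<le> order x G" if "x \<in> M" for x
  proof -
    have "poly ((log_derivation ^^ n) G) x = 0" if "n < A" for n
    proof -
      have "poly ((log_derivation ^^ n) G) x =
          poly (\<Sum>(c, a, \<beta>)\<in>I. smult (v (c, a, \<beta>)) (reduced_derivative (poly trunc_log x) n a \<beta> c)) x"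
        using \<open>x \<in> M\<close> unfolding G_def
        by (simp add: funpow_log_derivation_sum funpow_log_derivation_smult case_prod_unfold poly_sum
              poly_funpow_log_derivation_stepanov_monom M_def p_def)
      also have "\<dots> = 0" using \<open>x \<in> M\<close> that by (subst red0) (auto simp: M_def)
      finally show ?thesis .
    qed
    moreover have "A \<le> p" by (simp add: A_def)
    ultimately have "[:-x, 1:] ^ A dvd G"
      using \<open>x \<in> M\<close> by (intro linear_power_dvd_if_log_derivations_vanish) (auto simp: M_def p_def)
    with \<open>G \<noteq> 0\<close> show ?thesis by (simp add: order_divides)
  qed
  then have "card M * A \<le> (\<Sum>x\<in>M. order x G)"
    using sum_bounded_below[of M A "\<lambda>x. order x G"] by simp
  also have "\<dots> \<le> degree G" by (rule sum_order_le_degree) (use \<open>G \<noteq> 0\<close> in auto)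
  also have "\<dots> < 2 * p * b"
    unfolding G_def
  proof (rule degree_sum_less)
    show "degree (case i of (c, a, \<beta>) \<Rightarrow> smult (v (c, a, \<beta>)) (stepanov_monom a \<beta> c)) < 2 * p * b"
      if "i \<in> I" for i
    proof -
      obtain c a \<beta> where i: "i = (c, a, \<beta>)" by (cases i)
      with that have *: "c < b" "a < A" "\<beta> < b" by (auto simp: I_def)
      have "degree (stepanov_monom a \<beta> c :: 'a poly) \<le> 1 * a + (p - 1) * \<beta> + (1 * p) * c"
        unfolding stepanov_monom_def p_def
        by (intro order.trans[OF degree_mult_le] add_mono order.trans[OF degree_power_le] mult_right_mono
            degree_trunc_log) auto
      also have "\<dots> \<le> a + p * (b - 1) + p * (b - 1)"
        using * by (intro add_mono mult_le_mono) auto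
      also have "\<dots> < p + p * (b - 1) + p * (b - 1)"
        using * div_le_dividend[of p b] unfolding A_def by linarith
      also have "\<dots> \<le> 2 * p * b" using \<open>b > 0\<close> by (cases b) auto
      finally show ?thesis using degree_smult_le le_less_trans by (fastforce simp: i)
    qed
  qed (use \<open>b > 0\<close> in \<open>simp add: p_def\<close>)
  \<comment> \<open>Rounding down in \<open>A\<close> costs at most a factor 2, which turns the
    degree bound \<open>2 * p * b\<close> into \<open>4 * b ^ 2 * A\<close>.\<close>
  also have "p \<le> 2 * A * b"
  proof -
    have "p < Suc A * b" using \<open>b > 0\<close> by (simp add: A_def dividend_less_div_times)
    also have "\<dots> \<le> 2 * A * b" using bA \<open>b > 0\<close> by (intro mult_right_mono) auto
    finally show ?thesis by simp
  qed
  then have "2 * p * b \<le> 4 * b ^ 2 * A" by (simp add: power2_eq_square)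
  finally have "card M < 4 * b ^ 2" by simp
  then show ?thesis by (simp add: M_def p_def)
qed

section \<open>Fibers of the truncated logarithm\<close>

text \<open>The condition \<open>x ^ CHAR('a) = x\<close> cuts out the prime field. The points 0 and
  1 are left out because X (1 - X) vanishes there.\<close>

definition trunc_log_fiber :: "'a::finite_field \<Rightarrow> 'a set" where
  "trunc_log_fiber k = {x. x ^ CHAR('a) = x \<and> x \<noteq> 0 \<and> x \<noteq> 1 \<and> poly trunc_log x = k}"

lemma card_Frobenius_fixed_le: "card {x :: 'a::finite_field. x ^ CHAR('a) = x} \<le> CHAR('a)"
proof -
  define P where "P = monom 1 (CHAR('a)) - [:0, 1 :: 'a:]"
  have "CHAR('a) > 1" using CHAR_prime[where 'a = 'a] prime_gt_1_nat by blast
  then have deg: "degree P = CHAR('a)"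
    unfolding P_def by (subst diff_conv_add_uminus, subst degree_add_eq_left) (simp_all add: degree_monom_eq)
  then have "P \<noteq> 0" using CHAR_pos[where 'a = 'a] by (metis degree_0 less_irrefl)
  moreover have "{x. x ^ CHAR('a) = x} = {x. poly P x = 0}" by (auto simp: P_def poly_monom)
  ultimately show ?thesis using deg card_poly_roots_bound[of P] by simp
qed

lemma sum_card_trunc_log_fiber:
  "(\<Sum>k\<in>R. card (trunc_log_fiber k)) =
     card {x :: 'a::finite_field. x ^ CHAR('a) = x \<and> x \<noteq> 0 \<and> x \<noteq> 1 \<and> poly trunc_log x \<in> R}"
proof -
  have "(\<Sum>k\<in>R. card (trunc_log_fiber k)) = card (\<Union>k\<in>R. trunc_log_fiber k)"
    by (rule card_UN_disjoint[symmetric]) (auto simp: trunc_log_fiber_def)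
  also have "(\<Union>k\<in>R. trunc_log_fiber k) = {x. x ^ CHAR('a) = x \<and> x \<noteq> 0 \<and> x \<noteq> 1 \<and> poly trunc_log x \<in> R}"
    by (auto simp: trunc_log_fiber_def)
  finally show ?thesis .
qed

text \<open>The \<open>\<rho>\<close> rich values have at least \<open>\<rho> * t\<close> preimages,
  while Stepanov's bound with \<open>b ^ 3\<close> of size \<open>\<rho> * p\<close> allows only a
  multiple of \<open>(\<rho> * p) powr (2/3)\<close>. Cubing and cancelling powers of
  \<open>\<rho>\<close> gives the claim, with \<open>36864 = 64 * 576\<close>.\<close>

lemma card_rich_le:
  "card {k :: 'a::finite_field. t \<le> card (trunc_log_fiber k)} * t ^ 3 \<le> 36864 * CHAR('a) ^ 2"
proof -
  define p where "p = CHAR('a)"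
  define R where "R = {k :: 'a. t \<le> card (trunc_log_fiber k)}"
  define \<rho> where "\<rho> = card R"
  define M where "M = {x :: 'a. x ^ p = x \<and> x \<noteq> 0 \<and> x \<noteq> 1 \<and> poly trunc_log x \<in> R}"
  have "\<rho> * t \<le> (\<Sum>k\<in>R. card (trunc_log_fiber k))"
    using sum_bounded_below[of R t "\<lambda>k. card (trunc_log_fiber k)"] by (simp add: R_def \<rho>_def)
  also have "\<dots> = card M" by (simp add: sum_card_trunc_log_fiber M_def p_def)
  finally have tM: "\<rho> * t \<le> card M" .
  have Mp: "card M \<le> p"
    using card_Frobenius_fixed_le[where 'a = 'a] unfolding M_def p_def
    by (rule order.trans[OF card_mono, rotated 2]) auto
  have "\<rho> * (\<rho> ^ 2 * (\<rho> * t ^ 3)) \<le> \<rho> * (\<rho> ^ 2 * (36864 * p ^ 2))"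
  proof (cases "\<rho> = 0")
    case False
    have "p > 0" by (simp add: p_def)
    \<comment> \<open>The least admissible \<open>b\<close>. Minimality together with
      \<open>b \<le> 2 * (b - 1)\<close> gives \<open>b ^ 3 \<le> 24 * \<rho> * p\<close>.\<close>
    define b where "b = (LEAST b. 3 * \<rho> * p < b ^ 3)"
    have "3 * \<rho> * p < (3 * \<rho> * p + 1) ^ 3"
      by (rule less_le_trans[of _ "(3 * \<rho> * p + 1) ^ 1"]) (simp, intro power_increasing, auto)
    then have b: "3 * \<rho> * p < b ^ 3" unfolding b_def by (rule LeastI)
    have "b \<noteq> 0" "b \<noteq> 1" using b False \<open>p > 0\<close> by (auto intro!: Nat.gr0I)
    then have b2: "b \<le> 2 * (b - 1)" by simp
    have "\<not> 3 * \<rho> * p < (b - 1) ^ 3"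
      using \<open>b \<noteq> 0\<close> unfolding b_def by (intro not_less_Least) simp
    then have "8 * (b - 1) ^ 3 \<le> 24 * \<rho> * p" by simp
    moreover have "b ^ 3 \<le> (2 * (b - 1)) ^ 3" using b2 by (rule power_mono) simp
    ultimately have b3: "b ^ 3 \<le> 24 * \<rho> * p" by (simp add: power_mult_distrib)
    then have "(b ^ 3) ^ 2 \<le> (24 * \<rho> * p) ^ 2" by (rule power_mono) simp
    then have b6: "b ^ 6 \<le> 576 * \<rho> ^ 2 * p ^ 2" by (simp add: power_mult_distrib flip: power_mult)
    have "(\<rho> * t) ^ 3 \<le> 36864 * \<rho> ^ 2 * p ^ 2"
    proof (cases "b ^ 2 \<le> p")
      case True
      then have "card M \<le> 4 * b ^ 2"
        using b card_trunc_log_preimage_le[of b R] by (simp add: M_def p_def \<rho>_def)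
      with tM have "(\<rho> * t) ^ 3 \<le> (4 * b ^ 2) ^ 3" by (intro power_mono) simp_all
      also have "\<dots> = 64 * b ^ 6" by (simp add: power_mult_distrib flip: power_mult)
      finally show ?thesis using b6 by simp
    next
      case False
      \<comment> \<open>Outside the range of Stepanov's bound, the trivial bound \<open>p\<close>
        for \<open>card M\<close> is already below \<open>b ^ 2\<close>.\<close>
      then have "p ^ 3 \<le> (b ^ 2) ^ 3" by (intro power_mono) simp_all
      then have "p ^ 3 \<le> 576 * \<rho> ^ 2 * p ^ 2" using b6 by (simp flip: power_mult)
      moreover have "(\<rho> * t) ^ 3 \<le> p ^ 3" using tM Mp by (intro power_mono) simp_all
      ultimately show ?thesis by linarith
    qed
    then have "\<rho> * (\<rho> * t) ^ 3 \<le> \<rho> * (36864 * \<rho> ^ 2 * p ^ 2)" by (rule mult_le_mono2)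
    then show ?thesis by (simp add: power_mult_distrib power2_eq_square power3_eq_cube mult_ac)
  qed simp
  then have "\<rho> = 0 \<or> \<rho> * t ^ 3 \<le> 36864 * p ^ 2" by auto
  then show ?thesis by (auto simp: \<rho>_def R_def p_def)
qed

section \<open>Third moment of the fiber sizes\<close>

lemma sum_inverse_le: "n > 0 \<Longrightarrow> (\<Sum>t = 1..n. 1 / real t) \<le> 1 + ln (real n)"
proof (induction n rule: nat_induct_non_zero)
  case (Suc n)
  have "ln (real n / real (Suc n)) \<le> real n / real (Suc n) - 1"
    using Suc.hyps by (intro ln_le_minus_one) simp
  then have "1 / real (Suc n) \<le> ln (real (Suc n)) - ln (real n)"
    using Suc.hyps by (simp add: ln_div field_simps)
  then show ?case using Suc.IH by simp
qed simp

lemma cube_le_sum_squares: "n ^ 3 \<le> 3 * (\<Sum>t = 1..n. t ^ 2 :: nat)"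
  by (induction n) (auto simp: power2_eq_square power3_eq_cube algebra_simps)

text \<open>Summation by levels: \<open>N ^ 3\<close> is at most three times the sum of
  \<open>t ^ 2\<close> over \<open>t \<le> N\<close>. With \<open>card_rich_le\<close>, level
  \<open>t\<close> contributes a multiple of \<open>p ^ 2 / t\<close>, and the harmonic sum yields
  the logarithm.\<close>

lemma sum_card_trunc_log_fiber_cube_le:
  "real (\<Sum>k\<in>UNIV. card (trunc_log_fiber (k :: 'a::finite_field)) ^ 3)
     \<le> 221184 * real (CHAR('a)) ^ 2 * log 2 (real CHAR('a))"
proof -
  define p where "p = CHAR('a)"
  have p: "p \<ge> 2" using prime_ge_2_nat[OF CHAR_prime[where 'a = 'a]] by (simp add: p_def)
  define N where "N k = card (trunc_log_fiber (k :: 'a))" for k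
  have Np: "N k \<le> p" for k
    using card_Frobenius_fixed_le[where 'a = 'a] unfolding N_def p_def
    by (rule order.trans[OF card_mono, rotated 2]) (auto simp: trunc_log_fiber_def)
  have "(\<Sum>k\<in>UNIV. N k ^ 3) \<le> (\<Sum>k\<in>UNIV. 3 * (\<Sum>t = 1..p. if t \<le> N k then t ^ 2 else 0))"
  proof (rule sum_mono)
    fix k
    have "(\<Sum>t = 1..N k. t ^ 2) = (\<Sum>t = 1..p. if t \<le> N k then t ^ 2 else 0)"
      by (rule sum.mono_neutral_cong_left) (use Np in \<open>auto intro: order.trans\<close>)
    then show "N k ^ 3 \<le> 3 * (\<Sum>t = 1..p. if t \<le> N k then t ^ 2 else 0)"
      using cube_le_sum_squares[of "N k"] by simp
  qed
  also have "\<dots> = 3 * (\<Sum>t = 1..p. \<Sum>k\<in>UNIV. if t \<le> N k then t ^ 2 else 0)"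
    unfolding sum_distrib_left[symmetric] by (subst sum.swap) simp
  also have "\<dots> = 3 * (\<Sum>t = 1..p. card {k. t \<le> N k} * t ^ 2)"
    by (simp add: sum.If_cases)
  finally have "real (\<Sum>k\<in>UNIV. N k ^ 3) \<le> 3 * (\<Sum>t = 1..p. real (card {k. t \<le> N k}) * real t ^ 2)"
    by (simp flip: of_nat_sum of_nat_mult of_nat_power of_nat_le_iff)
  also have "\<dots> \<le> 3 * (\<Sum>t = 1..p. 36864 * real p ^ 2 * (1 / real t))"
  proof (intro mult_left_mono sum_mono)
    fix t assume t: "t \<in> {1..p}"
    have "real (card {k. t \<le> N k} * t ^ 3) \<le> real (36864 * p ^ 2)"
      using card_rich_le[of t, where 'a = 'a] by (simp only: N_def p_def of_nat_le_iff)
    then show "real (card {k. t \<le> N k}) * real t ^ 2 \<le> 36864 * real p ^ 2 * (1 / real t)"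
      using t by (simp add: field_simps power2_eq_square power3_eq_cube)
  qed simp
  also have "\<dots> = 110592 * real p ^ 2 * (\<Sum>t = 1..p. 1 / real t)"
    by (simp add: sum_distrib_left)
  also have "\<dots> \<le> 110592 * real p ^ 2 * (2 * log 2 (real p))"
  proof (rule mult_left_mono)
    have "1 \<le> log 2 (real p)" using p by simp
    moreover have "ln (real p) \<le> log 2 (real p)"
    proof -
      have "0 < ln (2::real)" "ln (2::real) \<le> 1" using ln_2_less_1 by auto
      moreover have "0 \<le> ln (real p)" using p by simp
      ultimately show ?thesis by (simp add: log_def field_simps mult_left_le)
    qed
    ultimately show "(\<Sum>t = 1..p. 1 / real t) \<le> 2 * log 2 (real p)"
      using sum_inverse_le[of p] p by linarith
  qed simp
  finally show ?thesis by (simp add: N_def p_def)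
qed

section \<open>Fermat quotients as values of the truncated logarithm\<close>

lemma of_nat_choose_CHAR_minus_1:
  "i < CHAR('a) \<Longrightarrow> of_nat ((CHAR('a) - 1) choose i) = ((-1) ^ i :: 'a::field_prime_char)"
proof (induction i)
  case (Suc i)
  define p where "p = CHAR('a)"
  have p: "prime p" "Suc (p - 1) = p" using CHAR_pos[where 'a = 'a] by (auto simp: p_def)
  \<comment> \<open>By Pascal's rule, consecutive entries of row \<open>p - 1\<close> add up to an
    entry of row \<open>p\<close>, which is 0 in the field; so the signs alternate.\<close>
  have "p dvd (p choose Suc i)" using Suc.prems p by (intro dvd_choose_prime) (auto simp: p_def)
  then have "of_nat (p choose Suc i) = (0 :: 'a)" by (simp add: of_nat_eq_0_iff_char_dvd p_def)
  also have "p choose Suc i = ((p - 1) choose i) + ((p - 1) choose Suc i)"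
    using binomial_Suc_Suc[of "p - 1" i] p by simp
  finally show ?case using Suc by (simp add: p_def add_eq_0_iff)
qed simp

text \<open>Expand \<open>(m - 1) ^ p\<close> and divide by \<open>p\<close>: the quotient of
  \<open>p choose j\<close> by \<open>p\<close> is \<open>(-1) ^ (j - 1) / j\<close> in the field,
  so the coefficients become those of \<open>trunc_log\<close>.\<close>

lemma of_int_Fermat_quotient_eq_trunc_log:
  assumes "odd CHAR('a::field_prime_char)"
  shows "\<exists>q. int CHAR('a) * q = 1 + (m - 1) ^ CHAR('a) - m ^ CHAR('a)
           \<and> of_int q = poly trunc_log (of_int m :: 'a)"
proof -
  define p where "p = CHAR('a)"
  have p: "prime p" "p > 0" by (auto simp: p_def)
  define d where "d j = (p choose j) div p" for j
  have d: "p choose j = p * d j" if "j \<in> {1..<p}" for j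
    using that p by (simp add: d_def dvd_choose_prime)
  define q where "q = (\<Sum>j = 1..<p. int (d j) * m ^ j * (-1) ^ (p - j))"
  have "(m - 1) ^ p = (\<Sum>j\<le>p. int (p choose j) * m ^ j * (-1) ^ (p - j))"
    using binomial_ring[of m "-1" p] by simp
  \<comment> \<open>For odd \<open>p\<close> the extreme terms are -1 and \<open>m ^ p\<close>,
    which cancel against the rest of the expression.\<close>
  also have "{..p} = insert 0 (insert p {1..<p})" using p(2) by auto
  finally have "1 + (m - 1) ^ p - m ^ p = (\<Sum>j = 1..<p. int (p choose j) * m ^ j * (-1) ^ (p - j))"
    using assms p(2) by (simp add: p_def[symmetric])
  also have "\<dots> = int p * q"
    unfolding q_def sum_distrib_left by (intro sum.cong refl) (simp add: d)
  finally have 1: "int p * q = 1 + (m - 1) ^ p - m ^ p" ..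
  have "of_nat (d j) * (-1) ^ (p - j) = (inverse (of_nat j) :: 'a)" if j: "j \<in> {1..<p}" for j
  proof -
    have "p * (j * d j) = j * (p choose j)" using d[OF j] by simp
    also have "\<dots> = p * ((p - 1) choose (j - 1))" using j by (intro times_binomial_minus1_eq) simp
    finally have "j * d j = (p - 1) choose (j - 1)" using p by simp
    then have "of_nat j * of_nat (d j) = (of_nat ((p - 1) choose (j - 1)) :: 'a)"
      by (simp flip: of_nat_mult)
    also have "\<dots> = (-1) ^ (j - 1)" using j unfolding p_def
      by (intro of_nat_choose_CHAR_minus_1) (simp add: less_imp_diff_less)
    finally have "of_nat j * (of_nat (d j) * (-1) ^ (p - j)) = ((-1) ^ (j - 1) * (-1) ^ (p - j) :: 'a)"
      by (simp add: mult.assoc[symmetric])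
    also have "\<dots> = (-1) ^ (p - 1)" using j by (simp flip: power_add)
    also have "\<dots> = 1" using assms by (simp add: p_def)
    finally show ?thesis by (simp add: inverse_unique)
  qed
  then have "of_int q = (\<Sum>j = 1..<p. inverse (of_nat j) * (of_int m :: 'a) ^ j)"
    unfolding q_def of_int_sum by (intro sum.cong refl) (simp add: mult_ac)
  also have "\<dots> = poly trunc_log (of_int m)"
    by (simp add: trunc_log_def poly_sum poly_monom p_def)
  finally show ?thesis using 1 unfolding p_def by blast
qed

section \<open>Sums over multiplicatively invariant sets\<close>

definition add_char :: "nat \<Rightarrow> int \<Rightarrow> complex" where
  "add_char N k = cis (2 * pi * of_int k / of_nat N)"

lemma add_char_add: "add_char N (j + k) = add_char N j * add_char N k"
  by (simp add: add_char_def cis_mult add_divide_distrib algebra_simps)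

lemma add_char_0 [simp]: "add_char N 0 = 1"
  by (simp add: add_char_def)

lemma cnj_add_char: "cnj (add_char N k) = add_char N (- k)"
  by (simp add: add_char_def cis_cnj)

lemma add_char_eq_1_iff:
  assumes "N > 0"
  shows "add_char N k = 1 \<longleftrightarrow> int N dvd k"
proof
  assume "add_char N k = 1"
  then have "cos (2 * pi * of_int k / of_nat N) = 1" by (simp add: add_char_def complex_eq_iff)
  then obtain n :: int where "2 * pi * of_int k / of_nat N = n * 2 * pi" by (auto simp: cos_one_2pi_int)
  then have "real_of_int k = real_of_int (n * int N)" using assms by (simp add: field_simps)
  then have "k = n * int N" by (simp only: of_int_eq_iff)
  then show "int N dvd k" by simp
next
  assume "int N dvd k"
  then obtain n where "k = int N * n" by (elim dvdE)
  then have "2 * pi * of_int k / of_nat N = 2 * pi * of_int n" using assms by simp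
  then show "add_char N k = 1" by (simp only: add_char_def) simp
qed

lemma add_char_cong:
  assumes "N > 0" "[j = k] (mod int N)"
  shows "add_char N j = add_char N k"
proof -
  have "add_char N (j - k) = 1" using assms by (simp add: add_char_eq_1_iff cong_iff_dvd_diff)
  then show ?thesis using add_char_add[of N "j - k" k] by simp
qed

lemma sum_add_char:
  assumes "N > 0"
  shows "(\<Sum>t\<in>{0..<int N}. add_char N (t * k)) = (if int N dvd k then of_nat N else 0)"
proof -
  have pow: "add_char N (int n * k) = add_char N k ^ n" for n
    by (induction n) (simp_all add: add_char_add algebra_simps)
  have "(\<Sum>t\<in>{0..<int N}. add_char N (t * k)) = (\<Sum>n<N. add_char N k ^ n)"
    by (rule sum.reindex_bij_witness[of _ int nat]) (auto simp flip: pow)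
  also have "\<dots> = (if int N dvd k then of_nat N else 0)"
  proof (cases "int N dvd k")
    case True
    then have "add_char N k = 1" using assms by (simp add: add_char_eq_1_iff)
    with True show ?thesis by simp
  next
    case False
    then have "add_char N k \<noteq> 1" using assms by (simp add: add_char_eq_1_iff)
    moreover have "add_char N k ^ N = 1"
      using assms by (simp add: add_char_eq_1_iff flip: pow)
    ultimately show ?thesis using False by (simp add: geometric_sum)
  qed
  finally show ?thesis .
qed

text \<open>Here \<open>t\<close> stands for a reduced residue; the count is 0 for integers outside
  \<open>{0..<int N}\<close>.\<close>

definition diff_count :: "nat \<Rightarrow> int set \<Rightarrow> int \<Rightarrow> nat" where
  "diff_count N G t = card {(u, v) \<in> G \<times> G. (u - v) mod int N = t}"

definition additive_energy3 :: "nat \<Rightarrow> int set \<Rightarrow> nat" where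
  "additive_energy3 N G = (\<Sum>t\<in>{0..<int N}. diff_count N G t ^ 3)"

lemma sum_card_fiber_square:
  assumes "finite A" "finite T" "f ` A \<subseteq> T"
  shows "(\<Sum>t\<in>T. card {q \<in> A. f q = t} ^ 2) = card {(q, q') \<in> A \<times> A. f q = f q'}"
proof -
  have "card {(q, q') \<in> A \<times> A. f q = f q'} = (\<Sum>t\<in>T. card {z \<in> {(q, q') \<in> A \<times> A. f q = f q'}. f (fst z) = t})"
    unfolding card_eq_sum using assms by (intro sum.group[symmetric]) (auto intro: finite_subset[of _ "A \<times> A"])
  also have "\<dots> = (\<Sum>t\<in>T. card ({q \<in> A. f q = t} \<times> {q \<in> A. f q = t}))"
    by (intro sum.cong refl arg_cong[where f = card]) auto
  finally show ?thesis by (simp add: card_cartesian_product power2_eq_square)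
qed

lemma sum_card_fiber_cube:
  assumes "finite A" "finite T" "f ` A \<subseteq> T"
  shows "(\<Sum>t\<in>T. card {q \<in> A. f q = t} ^ 3) = card {(q, q', q'') \<in> A \<times> A \<times> A. f q = f q' \<and> f q = f q''}"
proof -
  have "card {(q, q', q'') \<in> A \<times> A \<times> A. f q = f q' \<and> f q = f q''} =
     (\<Sum>t\<in>T. card {z \<in> {(q, q', q'') \<in> A \<times> A \<times> A. f q = f q' \<and> f q = f q''}. f (fst z) = t})"
    unfolding card_eq_sum using assms
    by (intro sum.group[symmetric]) (auto intro: finite_subset[of _ "A \<times> A \<times> A"])
  also have "\<dots> = (\<Sum>t\<in>T. card ({q \<in> A. f q = t} \<times> {q \<in> A. f q = t} \<times> {q \<in> A. f q = t}))"
    by (intro sum.cong refl arg_cong[where f = card]) auto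
  finally show ?thesis by (simp add: card_cartesian_product power3_eq_cube mult.assoc)
qed

lemma sum_product3:
  fixes f g h :: "'i \<Rightarrow> 'a::comm_semiring_0"
  shows "sum f A * sum g B * sum h C = (\<Sum>(i, j, k)\<in>A \<times> B \<times> C. f i * g j * h k)"
proof -
  have "sum f A * sum g B * sum h C = (\<Sum>i\<in>A. f i * (\<Sum>j\<in>B. \<Sum>k\<in>C. g j * h k))"
    by (simp only: mult.assoc sum_product[of g B h C]) (rule sum_distrib_right)
  then show ?thesis by (simp add: sum_distrib_left mult.assoc flip: sum.cartesian_product)
qed

text \<open>\<open>perm\<close> makes the sum \<open>K\<close> constant on \<open>G\<close>, and
  \<open>coprime_a\<close> keeps the orthogonality relations intact after scaling by
  \<open>a\<close>.\<close>

locale mult_invariant_sum =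
  fixes N :: nat and a :: int and G :: "int set"
  assumes N_pos: "N > 0"
    and coprime_a: "coprime a (int N)"
    and fin: "finite G"
    and perm: "g \<in> G \<Longrightarrow> bij_betw (\<lambda>x. g * x mod int N) G G"
begin

text \<open>The Fourier transform of the indicator function of \<open>G\<close>, at frequency
  \<open>a * t\<close>.\<close>

definition K :: "int \<Rightarrow> complex" where
  "K t = (\<Sum>u\<in>G. add_char N (a * u * t))"

definition S :: complex where
  "S = K 1"

lemma K_cong: "[s = t] (mod int N) \<Longrightarrow> K s = K t"
  unfolding K_def by (intro sum.cong refl add_char_cong N_pos cong_mult cong_refl)

lemma K_uminus: "K (- t) = cnj (K t)"
  by (simp add: K_def cnj_add_char)

lemma K_invariant:
  assumes "g \<in> G"
  shows "K g = S"
proof -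
  have "K g = (\<Sum>u\<in>G. add_char N (a * (g * u mod int N)))"
    unfolding K_def by (intro sum.cong refl add_char_cong N_pos)
      (simp add: cong_def mod_mult_right_eq mult_ac)
  also have "\<dots> = (\<Sum>u\<in>G. add_char N (a * u))"
    by (rule sum.reindex_bij_betw[OF perm[OF assms]])
  finally show ?thesis by (simp add: S_def K_def)
qed

text \<open>The matrix \<open>K (x - y)\<close> on \<open>G\<close> is positive semidefinite, and by invariance the constant
  vector is an eigenvector with eigenvalue \<open>\<bar>S\<bar>\<^sup>2\<close>; hence its cube has trace at least \<open>\<bar>S\<bar>\<^sup>6\<close>.\<close>

lemma norm_S_power6_le_trace:
  "norm S ^ 6 \<le> (\<Sum>(x, y, z)\<in>G \<times> G \<times> G. norm (K (x - y)) * norm (K (x - z)) * norm (K (y - z)))"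
proof (cases "G = {}")
  case True
  then have "S = 0" unfolding S_def K_def by simp
  moreover have "0 \<le> (\<Sum>(x, y, z)\<in>G \<times> G \<times> G. norm (K (x - y)) * norm (K (x - z)) * norm (K (y - z)))"
    by (intro sum_nonneg) auto
  ultimately show ?thesis by (simp only: norm_zero) simp
next
  case False
  \<comment> \<open>The matrix \<open>K (x - y)\<close> applied to the character vector of
    \<open>u\<close>. These vectors, for \<open>u \<in> G\<close>, factor the matrix, which is why
    it is positive semidefinite.\<close>
  define h where "h u x = (\<Sum>y\<in>G. K (x - y) * add_char N (a * u * y))" for u x
  \<comment> \<open>All column sums equal \<open>\<bar>S\<bar>\<^sup>2\<close>: this is the
    eigenvalue of the constant vector.\<close>
  have K_sum: "(\<Sum>x\<in>G. K (x - y)) = S * cnj S" if "y \<in> G" for y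
  proof -
    have "(\<Sum>x\<in>G. K (x - y)) = (\<Sum>x\<in>G. \<Sum>v\<in>G. add_char N (- (a * v * y)) * add_char N (a * x * v))"
      unfolding K_def by (intro sum.cong refl) (simp add: algebra_simps flip: add_char_add)
    also have "\<dots> = (\<Sum>v\<in>G. add_char N (- (a * v * y)) * K v)"
      unfolding K_def sum_distrib_left by (rule sum.swap)
    also have "\<dots> = (\<Sum>v\<in>G. add_char N (a * v * (- y))) * S"
      by (simp add: K_invariant sum_distrib_right)
    also have "\<dots> = K (- y) * S" by (simp add: K_def)
    finally show ?thesis using that by (simp add: K_uminus K_invariant mult.commute)
  qed
  have h_sum: "(\<Sum>x\<in>G. h u x) = S * cnj S * S" if "u \<in> G" for u
  proof -
    have "(\<Sum>x\<in>G. h u x) = (\<Sum>y\<in>G. (\<Sum>x\<in>G. K (x - y)) * add_char N (a * u * y))"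
      unfolding h_def sum_distrib_right by (rule sum.swap)
    also have "\<dots> = (\<Sum>y\<in>G. S * cnj S * add_char N (a * u * y))"
      by (intro sum.cong refl) (simp only: K_sum)
    also have "\<dots> = S * cnj S * K u"
      unfolding K_def[of u] by (simp add: sum_distrib_left mult_ac)
    finally show ?thesis using that by (simp add: K_invariant)
  qed
  \<comment> \<open>For each \<open>u\<close>, Cauchy--Schwarz over \<open>x\<close> compares the
    component along the constant vector with the full norm of \<open>h u\<close>. The factor
    \<open>card G\<close> cancels.\<close>
  have "of_nat (card G) * norm S ^ 6 = (\<Sum>u\<in>G. norm (\<Sum>x\<in>G. h u x) ^ 2)"
    by (simp add: h_sum norm_mult power_mult_distrib flip: power_add power_mult)
  also have "\<dots> \<le> (\<Sum>u\<in>G. (\<Sum>x\<in>G. norm (h u x) ^ 2) * of_nat (card G))"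
    by (intro sum_mono order.trans[OF power_mono[OF norm_sum] sum_squared_le_sum_of_squares]) auto
  also have "\<dots> = of_nat (card G) * (\<Sum>u\<in>G. \<Sum>x\<in>G. norm (h u x) ^ 2)"
    by (simp add: sum_distrib_left mult.commute)
  finally have "norm S ^ 6 \<le> (\<Sum>u\<in>G. \<Sum>x\<in>G. norm (h u x) ^ 2)"
    using False fin by (simp add: card_gt_0_iff)
  also have "\<dots> = norm (of_real (\<Sum>u\<in>G. \<Sum>x\<in>G. norm (h u x) ^ 2) :: complex)"
    by (subst norm_of_real) (simp add: sum_nonneg)
  also have "of_real (\<Sum>u\<in>G. \<Sum>x\<in>G. norm (h u x) ^ 2) = (\<Sum>u\<in>G. \<Sum>x\<in>G. h u x * cnj (h u x))"
    by (simp only: of_real_sum complex_norm_square)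
  also have "\<dots> = (\<Sum>u\<in>G. \<Sum>(x, y, z)\<in>G \<times> G \<times> G. K (x - y) * cnj (K (x - z)) * add_char N (a * u * (y - z)))"
  proof (rule sum.cong[OF refl])
    fix u
    have "add_char N (a * u * (y - z)) = add_char N (a * u * y) * cnj (add_char N (a * u * z))" for y z
      by (simp add: cnj_add_char algebra_simps flip: add_char_add)
    then show "(\<Sum>x\<in>G. h u x * cnj (h u x)) =
        (\<Sum>(x, y, z)\<in>G \<times> G \<times> G. K (x - y) * cnj (K (x - z)) * add_char N (a * u * (y - z)))"
      by (simp add: h_def sum_product mult_ac flip: sum.cartesian_product)
  qed
  \<comment> \<open>Summing the characters over \<open>u\<close> produces the third entry
    \<open>K (y - z)\<close>: the expression is the trace of the cube.\<close>
  also have "\<dots> = (\<Sum>(x, y, z)\<in>G \<times> G \<times> G. K (x - y) * cnj (K (x - z)) * K (y - z))"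
    unfolding K_def[of "_ - _"] 
    by (subst sum.swap) (simp add: K_def sum_distrib_left case_prod_unfold)
  also have "norm \<dots> \<le> (\<Sum>(x, y, z)\<in>G \<times> G \<times> G. norm (K (x - y)) * norm (K (x - z)) * norm (K (y - z)))"
    by (intro order.trans[OF norm_sum] sum_mono) (auto simp: norm_mult)
  finally show ?thesis .
qed

text \<open>Expanding the square and grouping pairs by their difference exhibits it as the Fourier
  transform of \<open>diff_count\<close>.\<close>

lemma norm_K_square:
  "of_real (norm (K t) ^ 2) = (\<Sum>s\<in>{0..<int N}. of_nat (diff_count N G s) * add_char N (a * s * t))"
proof -
  have "of_real (norm (K t) ^ 2) = K t * cnj (K t)" by (rule complex_norm_square)
  also have "\<dots> = (\<Sum>z\<in>G \<times> G. add_char N (a * (fst z - snd z) * t))"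
    unfolding K_def cnj_sum sum_product
    by (simp add: cnj_add_char algebra_simps case_prod_unfold sum.cartesian_product flip: add_char_add)
  also have "\<dots> = (\<Sum>z\<in>G \<times> G. add_char N (a * ((fst z - snd z) mod int N) * t))"
    by (intro sum.cong refl add_char_cong N_pos cong_mult cong_refl) (simp add: cong_sym)
  finally have "of_real (norm (K t) ^ 2) = (\<Sum>z\<in>G \<times> G. add_char N (a * ((fst z - snd z) mod int N) * t))" .
  also have "\<dots> = (\<Sum>s\<in>{0..<int N}. of_nat (card {z \<in> G \<times> G. (fst z - snd z) mod int N = s}) * add_char N (a * s * t))"
    using N_pos fin by (intro sum_fun_comp) auto
  finally have "of_real (norm (K t) ^ 2) = \<dots>" .
  moreover have "{z \<in> G \<times> G. (fst z - snd z) mod int N = s} = {(u, v) \<in> G \<times> G. (u - v) mod int N = s}" for s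
    by auto
  ultimately show ?thesis unfolding diff_count_def by simp
qed

lemma diff_count_uminus: "diff_count N G ((- t) mod int N) = diff_count N G (t mod int N)"
proof -
  have "(u - v) mod int N = (- t) mod int N \<longleftrightarrow> (v - u) mod int N = t mod int N" for u v
    using cong_minus_minus_iff[of "u - v" "- t" "int N"] by (simp add: cong_def)
  then show ?thesis unfolding diff_count_def
    by (intro bij_betw_same_card[of "\<lambda>(u, v). (v, u)"] bij_betwI[where g = "\<lambda>(u, v). (v, u)"]) auto
qed

text \<open>After expanding all three squares, orthogonality in \<open>\<alpha>\<close> and
  \<open>\<beta>\<close> forces \<open>s = w\<close> and \<open>t = - w\<close>. The symmetry of
  \<open>diff_count\<close> turns what is left into cubes.\<close>

lemma sum_norm_K_square:
  "(\<Sum>(\<alpha>, \<beta>)\<in>{0..<int N} \<times> {0..<int N}. (norm (K \<alpha>) * norm (K \<beta>) * norm (K (\<beta> - \<alpha>))) ^ 2)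
     = of_nat (N ^ 2 * additive_energy3 N G)"
proof -
  define Z where "Z = {0..<int N}"
  define r where "r = diff_count N G"
  \<comment> \<open>The frequencies \<open>w\<close>, \<open>s\<close>, \<open>t\<close> belong to
    \<open>\<beta> - \<alpha>\<close>, \<open>\<alpha>\<close>, \<open>\<beta>\<close>; the phase is
    split into its \<open>\<alpha>\<close>-part and its \<open>\<beta>\<close>-part.\<close>
  define e where "e \<alpha> \<beta> = (\<lambda>(w, s, t). of_nat (r w * r s * r t)
      * (add_char N (\<alpha> * (a * (s - w))) * add_char N (\<beta> * (a * (t + w)))))" for \<alpha> \<beta>
  have "of_real (\<Sum>(\<alpha>, \<beta>)\<in>Z \<times> Z. (norm (K \<alpha>) * norm (K \<beta>) * norm (K (\<beta> - \<alpha>))) ^ 2)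
      = (\<Sum>\<alpha>\<in>Z. \<Sum>\<beta>\<in>Z. (of_real (norm (K (\<beta> - \<alpha>)) ^ 2) * of_real (norm (K \<alpha>) ^ 2) * of_real (norm (K \<beta>) ^ 2) :: complex))"
    by (simp add: power_mult_distrib mult_ac flip: sum.cartesian_product)
  also have "\<dots> = (\<Sum>\<alpha>\<in>Z. \<Sum>\<beta>\<in>Z. sum (e \<alpha> \<beta>) (Z \<times> Z \<times> Z))"
    unfolding norm_K_square Z_def[symmetric] r_def[symmetric] sum_product3
  proof (intro sum.cong refl, clarify)
    fix \<alpha> \<beta> w s t
    have "add_char N (\<alpha> * (a * (s - w))) * add_char N (\<beta> * (a * (t + w)))
        = add_char N (a * w * (\<beta> - \<alpha>)) * add_char N (a * s * \<alpha>) * add_char N (a * t * \<beta>)"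
      unfolding add_char_add[symmetric] by (rule arg_cong) (simp add: algebra_simps)
    then show "of_nat (r w) * add_char N (a * w * (\<beta> - \<alpha>)) * (of_nat (r s) * add_char N (a * s * \<alpha>)) *
        (of_nat (r t) * add_char N (a * t * \<beta>)) = e \<alpha> \<beta> (w, s, t)"
      by (simp add: e_def)
  qed
  also have "\<dots> = (\<Sum>\<alpha>\<in>Z. \<Sum>q\<in>Z \<times> Z \<times> Z. \<Sum>\<beta>\<in>Z. e \<alpha> \<beta> q)"
    by (intro sum.cong refl sum.swap)
  also have "\<dots> = (\<Sum>q\<in>Z \<times> Z \<times> Z. \<Sum>\<alpha>\<in>Z. \<Sum>\<beta>\<in>Z. e \<alpha> \<beta> q)"
    by (rule sum.swap)
  also have "\<dots> = (\<Sum>(w, s, t)\<in>Z \<times> Z \<times> Z. of_nat (r w * r s * r t)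
      * ((\<Sum>\<alpha>\<in>Z. add_char N (\<alpha> * (a * (s - w)))) * (\<Sum>\<beta>\<in>Z. add_char N (\<beta> * (a * (t + w))))))"
    by (intro sum.cong refl, clarify, simp only: e_def prod.case sum_product) (simp only: sum_distrib_left)
  also have "\<dots> = (\<Sum>w\<in>Z. \<Sum>s\<in>Z. \<Sum>t\<in>Z. of_nat (r w * r s * r t)
      * ((\<Sum>\<alpha>\<in>Z. add_char N (\<alpha> * (a * (s - w)))) * (\<Sum>\<beta>\<in>Z. add_char N (\<beta> * (a * (t + w))))))"
    by (simp only: sum.cartesian_product)
  also have "\<dots> = (\<Sum>w\<in>Z. \<Sum>s\<in>Z. \<Sum>t\<in>Z. if s = w \<and> t = (- w) mod int N then of_nat (r w * r s * r t) * of_nat N ^ 2 else 0)"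
  proof (intro sum.cong refl)
    fix w s t assume *: "w \<in> Z" "s \<in> Z" "t \<in> Z"
    have "int N dvd a * (s - w) \<longleftrightarrow> [s = w] (mod int N)"
      using coprime_a by (simp add: coprime_dvd_mult_right_iff coprime_commute cong_iff_dvd_diff)
    also have "\<dots> \<longleftrightarrow> s = w" using * by (auto simp: Z_def cong_def)
    finally have "int N dvd a * (s - w) \<longleftrightarrow> s = w" .
    moreover have "int N dvd a * (t + w) \<longleftrightarrow> [t = - w] (mod int N)"
      using coprime_a by (simp add: coprime_dvd_mult_right_iff coprime_commute cong_iff_dvd_diff)
    moreover have "\<dots> \<longleftrightarrow> t = (- w) mod int N" using * by (auto simp: Z_def cong_def)
    ultimately show "of_nat (r w * r s * r t) * ((\<Sum>\<alpha>\<in>Z. add_char N (\<alpha> * (a * (s - w)))) * (\<Sum>\<beta>\<in>Z. add_char N (\<beta> * (a * (t + w)))))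
       = (if s = w \<and> t = (- w) mod int N then of_nat (r w * r s * r t) * of_nat N ^ 2 else (0 :: complex))"
      using N_pos by (simp add: Z_def sum_add_char power2_eq_square)
  qed
  also have "\<dots> = (\<Sum>w\<in>Z. of_nat (r w * r w * r ((- w) mod int N)) * of_nat N ^ 2)"
  proof (rule sum.cong[OF refl])
    fix w assume w: "w \<in> Z"
    have m: "(- w) mod int N \<in> Z" using N_pos by (simp add: Z_def)
    have "(\<Sum>s\<in>Z. \<Sum>t\<in>Z. if s = w \<and> t = (- w) mod int N then of_nat (r w * r s * r t) * of_nat N ^ 2 else (0 :: complex))
      = (\<Sum>s\<in>Z. if s = w then (\<Sum>t\<in>Z. if t = (- w) mod int N then of_nat (r w * r s * r t) * of_nat N ^ 2 else 0) else 0)"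
      by (intro sum.cong) auto
    also have "\<dots> = of_nat (r w * r w * r ((- w) mod int N)) * of_nat N ^ 2"
      using w m by (simp add: Z_def)
    finally show "(\<Sum>s\<in>Z. \<Sum>t\<in>Z. if s = w \<and> t = (- w) mod int N then of_nat (r w * r s * r t) * of_nat N ^ 2 else (0 :: complex))
      = of_nat (r w * r w * r ((- w) mod int N)) * of_nat N ^ 2" .
  qed
  also have "\<dots> = (\<Sum>w\<in>Z. of_nat (r w ^ 3) * of_nat N ^ 2)"
    using diff_count_uminus by (intro sum.cong) (simp_all add: Z_def r_def power3_eq_cube)
  also have "\<dots> = of_real (of_nat (N ^ 2 * additive_energy3 N G))"
    by (simp add: additive_energy3_def Z_def r_def sum_distrib_left mult.commute)
  finally show ?thesis unfolding Z_def of_real_eq_iff .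
qed

text \<open>\<open>x - y = x' - y'\<close> and \<open>x - z = x' - z'\<close> together say
  \<open>x - x' = y - y' = z - z'\<close>, so both sides count the same sextuples.\<close>

lemma sum_triple_diff_count_square:
  "(\<Sum>j\<in>{0..<int N} \<times> {0..<int N}. card {q \<in> G \<times> G \<times> G.
      (case q of (x, y, z) \<Rightarrow> ((x - y) mod int N, (x - z) mod int N)) = j} ^ 2) = additive_energy3 N G"
proof -
  let ?f = "\<lambda>(x, y, z). ((x - y) mod int N, (x - z) mod int N)"
  let ?A = "{(q, q') \<in> (G \<times> G \<times> G) \<times> (G \<times> G \<times> G). ?f q = ?f q'}"
  let ?g = "\<lambda>(u, v). (u - v) mod int N"
  let ?B = "{(q, q', q'') \<in> (G \<times> G) \<times> (G \<times> G) \<times> (G \<times> G). ?g q = ?g q' \<and> ?g q = ?g q''}"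
  have swap: "(x - y) mod int N = (x' - y') mod int N \<longleftrightarrow> (x - x') mod int N = (y - y') mod int N" for x y x' y'
    by (simp add: mod_eq_dvd_iff algebra_simps)
  have "(\<Sum>j\<in>{0..<int N} \<times> {0..<int N}. card {q \<in> G \<times> G \<times> G. ?f q = j} ^ 2) = card ?A"
    using fin N_pos by (intro sum_card_fiber_square) auto
  also have "card ?A = card ?B"
    by (intro bij_betw_same_card[of "\<lambda>((x, y, z), (x', y', z')). ((x, x'), (y, y'), (z, z'))"]
         bij_betwI[where g = "\<lambda>((x, x'), (y, y'), (z, z')). ((x, y, z), (x', y', z'))"])
       (auto simp: swap)
  also have "card ?B = additive_energy3 N G"
    unfolding additive_energy3_def diff_count_def
  proof -
    have "{(u, v). (u, v) \<in> G \<times> G \<and> (u - v) mod int N = t} = {q \<in> G \<times> G. ?g q = t}" for t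
      by auto
    then show "card ?B = (\<Sum>t\<in>{0..<int N}. card {(u, v) \<in> G \<times> G. (u - v) mod int N = t} ^ 3)"
      using fin N_pos by (subst sum_card_fiber_cube[symmetric, where T = "{0..<int N}"]) auto
  qed
  finally show ?thesis .
qed

text \<open>In the trace bound, \<open>y - z\<close> is determined by \<open>x - y\<close> and
  \<open>x - z\<close>. Grouping by these two differences and applying Cauchy--Schwarz gives the
  energy times \<open>N ^ 2\<close> times the energy.\<close>

theorem norm_sum_power6_le: "norm (\<Sum>u\<in>G. add_char N (a * u)) ^ 6 \<le> of_nat (N * additive_energy3 N G)"
proof -
  define Z where "Z = {0..<int N} \<times> {0..<int N}"
  define f where "f = (\<lambda>(x, y, z). ((x - y) mod int N, (x - z) mod int N))"
  define w where "w = (\<lambda>(\<alpha>, \<beta>). norm (K \<alpha>) * norm (K \<beta>) * norm (K (\<beta> - \<alpha>)))"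
  define c where "c j = real (card {q \<in> G \<times> G \<times> G. f q = j})" for j
  define T where "T = (\<Sum>(x, y, z)\<in>G \<times> G \<times> G. norm (K (x - y)) * norm (K (x - z)) * norm (K (y - z)))"
  have "T = (\<Sum>q\<in>G \<times> G \<times> G. w (f q))"
    unfolding T_def
  proof (intro sum.cong refl, clarify)
    fix x y z
    have "K ((x - y) mod int N) = K (x - y)" "K ((x - z) mod int N) = K (x - z)" for x y z
      by (rule K_cong; simp)+
    moreover have "K ((x - z) mod int N - (x - y) mod int N) = K (y - z)"
      by (rule K_cong) (simp add: cong_def mod_diff_eq)
    ultimately show "norm (K (x - y)) * norm (K (x - z)) * norm (K (y - z)) = w (f (x, y, z))"
      by (simp add: w_def f_def)
  qed
  also have "\<dots> = (\<Sum>j\<in>Z. c j * w j)"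
    unfolding c_def using fin N_pos by (intro sum_fun_comp) (auto simp: Z_def f_def)
  finally have "T ^ 2 \<le> (\<Sum>j\<in>Z. c j ^ 2) * (\<Sum>j\<in>Z. w j ^ 2)"
    using Cauchy_Schwarz_ineq_sum by simp
  also have "(\<Sum>j\<in>Z. c j ^ 2) = of_nat (additive_energy3 N G)"
    using sum_triple_diff_count_square by (simp add: c_def f_def Z_def flip: of_nat_power of_nat_sum)
  also have "(\<Sum>j\<in>Z. w j ^ 2) = of_nat (N ^ 2 * additive_energy3 N G)"
    using sum_norm_K_square by (simp add: w_def Z_def case_prod_unfold)
  finally have "T ^ 2 \<le> (of_nat (N * additive_energy3 N G)) ^ 2"
    by (simp add: power2_eq_square mult_ac)
  then have "T \<le> of_nat (N * additive_energy3 N G)"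
    by (rule power2_le_imp_le) simp
  then show ?thesis using norm_S_power6_le_trace by (simp add: T_def S_def K_def)
qed

end

section \<open>The group of \<open>p\<close>-th powers modulo \<open>p\<^sup>2\<close>\<close>

text \<open>In the factorization of \<open>x ^ p - y ^ p\<close>, the cofactor of
  \<open>x - y\<close> is congruent to \<open>p * y ^ (p - 1)\<close>, so it supplies a second
  factor \<open>p\<close>.\<close>

lemma cong_prime_power_lift:
  fixes x y :: int
  assumes "[x = y] (mod int p)"
  shows "[x ^ p = y ^ p] (mod int (p ^ 2))"
proof -
  have "[(\<Sum>i<p. y ^ (p - Suc i) * x ^ i) = (\<Sum>i<p. y ^ (p - Suc i) * y ^ i)] (mod int p)"
    by (intro cong_sum cong_mult cong_pow assms cong_refl)
  also have "(\<Sum>i<p. y ^ (p - Suc i) * y ^ i) = (\<Sum>i<p. y ^ (p - 1))"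
    by (intro sum.cong refl) (simp flip: power_add)
  also have "[\<dots> = 0] (mod int p)" by (simp add: cong_0_iff)
  finally have "int p dvd (\<Sum>i<p. y ^ (p - Suc i) * x ^ i)" by (simp add: cong_0_iff)
  moreover have "int p dvd x - y" using assms by (simp add: cong_iff_dvd_diff)
  ultimately have "int p * int p dvd (x - y) * (\<Sum>i<p. y ^ (p - Suc i) * x ^ i)"
    by (intro mult_dvd_mono)
  also have "\<dots> = x ^ p - y ^ p" by (rule power_diff_sumr2[symmetric])
  finally show ?thesis by (simp add: cong_iff_dvd_diff power2_eq_square)
qed

lemma Fermat_little_int:
  assumes "prime p"
  shows "[x ^ p = x] (mod int p)"
proof -
  have nat: "[m ^ p = m] (mod p)" for m :: nat
  proof (cases "p dvd m")
    case True
    moreover have "m dvd m ^ p" using prime_gt_0_nat[OF assms] by (simp add: dvd_power)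
    ultimately have "p dvd m ^ p" by (rule dvd_trans)
    with True show ?thesis by (simp add: cong_def mod_eq_0_iff_dvd)
  next
    case False
    from cong_scalar_left[OF fermat_theorem[OF assms False], of m] show ?thesis
      using prime_gt_0_nat[OF assms] by (simp flip: power_Suc)
  qed
  define m where "m = nat (x mod int p)"
  have m: "[x = int m] (mod int p)" using prime_gt_0_nat[OF assms] by (simp add: m_def cong_def)
  have "[x ^ p = int m ^ p] (mod int p)" by (rule cong_pow[OF m])
  also have "[int m ^ p = int m] (mod int p)" using nat[of m] by (simp flip: cong_int_iff)
  also have "[int m = x] (mod int p)" using m by (rule cong_sym)
  finally show ?thesis .
qed

text \<open>The bases \<open>{1..<p}\<close> suffice, since a \<open>p\<close>-th power modulo
  \<open>p ^ 2\<close> depends only on its base modulo \<open>p\<close>.\<close>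

definition pth_powers :: "nat \<Rightarrow> int set" where
  "pth_powers p = (\<lambda>m. int m ^ p mod int (p ^ 2)) ` {1..<p}"

context
  fixes p :: nat
  assumes prime_p: "prime p"
begin

lemma p_gt_1: "p > 1"
  using prime_p by (rule prime_gt_1_nat)

lemma prime_int_p: "prime (int p)"
  using prime_p by simp

lemma cong_mod_p: "[x = y] (mod int (p ^ 2)) \<Longrightarrow> [x = y] (mod int p)"
  by (rule cong_dvd_modulus, assumption) (simp add: power2_eq_square)

lemma cong_eq_square: "\<lbrakk>[x = y] (mod int (p ^ 2)); 0 \<le> x; x < int (p ^ 2); 0 \<le> y; y < int (p ^ 2)\<rbrakk> \<Longrightarrow> x = y"
  by (rule cong_less_imp_eq_int)

text \<open>Lifting Fermat's congruence makes each \<open>p\<close>-th power a fixed point of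
  \<open>u \<mapsto> u ^ p\<close>; conversely such a \<open>u\<close> is the \<open>p\<close>-th
  power of its residue modulo \<open>p\<close>. These are the Teichmueller representatives modulo
  \<open>p ^ 2\<close>.\<close>

lemma pth_powers_iff:
  "u \<in> pth_powers p \<longleftrightarrow> 0 \<le> u \<and> u < int (p ^ 2) \<and> [u ^ p = u] (mod int (p ^ 2)) \<and> \<not> int p dvd u"
proof safe
  assume "u \<in> pth_powers p"
  then obtain m where m: "1 \<le> m" "m < p" and u: "u = int m ^ p mod int (p ^ 2)"
    by (auto simp: pth_powers_def)
  show "0 \<le> u" "u < int (p ^ 2)" using p_gt_1 by (simp_all add: u del: of_nat_power)
  have um: "[u = int m ^ p] (mod int (p ^ 2))" by (simp add: u del: of_nat_power)
  also have "[int m ^ p = (int m ^ p) ^ p] (mod int (p ^ 2))"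
    by (intro cong_prime_power_lift cong_sym[OF Fermat_little_int] prime_p)
  also have "[(int m ^ p) ^ p = u ^ p] (mod int (p ^ 2))" by (intro cong_pow cong_sym[OF um])
  finally show "[u ^ p = u] (mod int (p ^ 2))" by (rule cong_sym)
  show False if "int p dvd u"
  proof -
    have "[u = int m] (mod int p)"
      using cong_mod_p[OF um] Fermat_little_int[OF prime_p, of "int m"] by (rule cong_trans)
    then have "int p dvd int m" using that by (simp only: cong_dvd_iff)
    then show False using m by (auto dest: dvd_imp_le)
  qed
next
  assume u: "0 \<le> u" "u < int (p ^ 2)" "[u ^ p = u] (mod int (p ^ 2))" "\<not> int p dvd u"
  define m where "m = nat (u mod int p)"
  have um: "[u = int m] (mod int p)" using p_gt_1 by (simp add: m_def cong_def)
  have "m \<noteq> 0" using um u(4) by (intro notI) (simp add: cong_0_iff)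
  moreover have "m < p" using p_gt_1 by (simp add: m_def nat_less_iff)
  moreover have "[u = int m ^ p] (mod int (p ^ 2))"
    using cong_sym[OF u(3)] cong_prime_power_lift[OF um] by (rule cong_trans)
  then have "u = int m ^ p mod int (p ^ 2)" using u(1,2) by (simp add: cong_def)
  ultimately show "u \<in> pth_powers p" unfolding pth_powers_def by force
qed

text \<open>Modulo \<open>p ^ 2\<close>, \<open>u = u ^ p = v ^ p = v\<close>, where the middle
  equality lifts the congruence modulo \<open>p\<close>.\<close>

lemma pth_powers_eqI:
  assumes "u \<in> pth_powers p" "v \<in> pth_powers p" "[u = v] (mod int p)"
  shows "u = v"
proof (rule cong_eq_square)
  have "[u = u ^ p] (mod int (p ^ 2))" using assms(1) by (simp add: pth_powers_iff cong_sym)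
  also have "[u ^ p = v ^ p] (mod int (p ^ 2))" by (rule cong_prime_power_lift[OF assms(3)])
  also have "[v ^ p = v] (mod int (p ^ 2))" using assms(2) by (simp add: pth_powers_iff)
  finally show "[u = v] (mod int (p ^ 2))" .
qed (use assms in \<open>auto simp: pth_powers_iff\<close>)

lemma finite_pth_powers: "finite (pth_powers p)"
  by (simp add: pth_powers_def)

lemma card_pth_powers_le: "card (pth_powers p) \<le> p"
  unfolding pth_powers_def by (rule order.trans[OF card_image_le]) simp_all

lemma bij_betw_mult_pth_powers:
  assumes g: "g \<in> pth_powers p"
  shows "bij_betw (\<lambda>x. g * x mod int (p ^ 2)) (pth_powers p) (pth_powers p)"
proof -
  have pg: "\<not> int p dvd g" using g by (simp add: pth_powers_iff)
  then have cop: "coprime g (int p)" using prime_imp_coprime[OF prime_int_p] by (simp add: coprime_commute)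
  have "(\<lambda>x. g * x mod int (p ^ 2)) ` pth_powers p \<subseteq> pth_powers p"
  proof clarify
    fix x assume x: "x \<in> pth_powers p"
    have gx: "[g * x mod int (p ^ 2) = g * x] (mod int (p ^ 2))" by simp
    have "[(g * x mod int (p ^ 2)) ^ p = (g * x) ^ p] (mod int (p ^ 2))" by (rule cong_pow[OF gx])
    also have "[(g * x) ^ p = g * x] (mod int (p ^ 2))"
      unfolding power_mult_distrib using g x by (intro cong_mult) (simp_all add: pth_powers_iff)
    also have "[g * x = g * x mod int (p ^ 2)] (mod int (p ^ 2))" using gx by (rule cong_sym)
    finally have "[(g * x mod int (p ^ 2)) ^ p = g * x mod int (p ^ 2)] (mod int (p ^ 2))" .
    moreover have "\<not> int p dvd g * x mod int (p ^ 2)"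
      using cong_dvd_iff[OF cong_mod_p[OF gx]] pg x prime_dvd_mult_iff[OF prime_int_p]
      by (simp add: pth_powers_iff)
    ultimately show "g * x mod int (p ^ 2) \<in> pth_powers p"
      using p_gt_1 unfolding pth_powers_iff by (simp del: of_nat_power)
  qed
  moreover have "inj_on (\<lambda>x. g * x mod int (p ^ 2)) (pth_powers p)"
  proof (rule inj_onI)
    fix x y assume xy: "x \<in> pth_powers p" "y \<in> pth_powers p" "g * x mod int (p ^ 2) = g * y mod int (p ^ 2)"
    then have "[g * x = g * y] (mod int p)" by (intro cong_mod_p) (simp add: cong_def)
    then have "[x = y] (mod int p)" by (simp add: cong_mult_lcancel[OF cop])
    then show "x = y" using xy by (intro pth_powers_eqI)
  qed
  ultimately show ?thesis using endo_inj_surj[OF finite_pth_powers] by (simp add: bij_betw_def)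
qed

text \<open>The 1 is the term \<open>n = p\<close>, as \<open>p ^ 2\<close> divides
  \<open>p ^ p\<close>. The other bases give distinct powers, since by Fermat each power determines
  its base modulo \<open>p\<close>.\<close>

lemma heilbronn_sum_eq: "heilbronn_sum p a = 1 + (\<Sum>u\<in>pth_powers p. add_char (p ^ 2) (a * u))"
proof -
  have p2: "p ^ 2 > 0" using p_gt_1 by simp
  have "heilbronn_sum p a = (\<Sum>m = 1..p. add_char (p ^ 2) (a * int m ^ p))"
    unfolding heilbronn_sum_def add_char_def cis_conv_exp
    by (intro sum.cong refl arg_cong[where f = exp]) simp
  also have "{1..p} = insert p {1..<p}" using p_gt_1 by auto
  also have "(\<Sum>m\<in>insert p {1..<p}. add_char (p ^ 2) (a * int m ^ p))
      = add_char (p ^ 2) (a * int p ^ p) + (\<Sum>m\<in>{1..<p}. add_char (p ^ 2) (a * int m ^ p))"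
    by simp
  also have "add_char (p ^ 2) (a * int p ^ p) = 1"
    using p_gt_1 by (simp add: add_char_eq_1_iff le_imp_power_dvd)
  also have "(\<Sum>m\<in>{1..<p}. add_char (p ^ 2) (a * int m ^ p))
      = (\<Sum>m\<in>{1..<p}. add_char (p ^ 2) (a * (int m ^ p mod int (p ^ 2))))"
    using p2 by (intro sum.cong refl add_char_cong) (auto simp: cong_def mod_mult_right_eq)
  also have "\<dots> = (\<Sum>u\<in>pth_powers p. add_char (p ^ 2) (a * u))"
    unfolding pth_powers_def
  proof (subst sum.reindex)
    show "inj_on (\<lambda>m. int m ^ p mod int (p ^ 2)) {1..<p}"
    proof (rule inj_onI)
      fix m n assume mn: "m \<in> {1..<p}" "n \<in> {1..<p}" "int m ^ p mod int (p ^ 2) = int n ^ p mod int (p ^ 2)"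
      have "[int m = int m ^ p] (mod int p)" by (rule cong_sym[OF Fermat_little_int[OF prime_p]])
      also have "[int m ^ p = int n ^ p] (mod int p)" using mn by (intro cong_mod_p) (simp add: cong_def)
      also have "[int n ^ p = int n] (mod int p)" by (rule Fermat_little_int[OF prime_p])
      finally show "m = n" using mn by (simp add: cong_int_iff cong_less_modulus_unique_nat)
    qed
  qed simp
  finally show ?thesis .
qed

lemma norm_sum_pth_powers_power6_le:
  assumes "\<not> int p dvd a"
  shows "norm (\<Sum>u\<in>pth_powers p. add_char (p ^ 2) (a * u)) ^ 6
           \<le> of_nat (p ^ 2 * additive_energy3 (p ^ 2) (pth_powers p))"
proof -
  have "coprime a (int p)" using assms prime_imp_coprime[OF prime_int_p] by (simp add: coprime_commute)
  then interpret mult_invariant_sum "p ^ 2" a "pth_powers p"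
    using p_gt_1 bij_betw_mult_pth_powers finite_pth_powers by unfold_locales simp_all
  show ?thesis by (rule norm_sum_power6_le)
qed

section \<open>Differences of \<open>p\<close>-th powers and fibers of the truncated
  logarithm\<close>

lemma diff_count_le_card: "diff_count (p ^ 2) (pth_powers p) t \<le> card (pth_powers p)"
  unfolding diff_count_def
proof (rule card_inj_on_le[of fst])
  show "inj_on fst {(u, v) \<in> pth_powers p \<times> pth_powers p. (u - v) mod int (p ^ 2) = t}"
  proof (rule inj_onI)
    fix z z' assume z: "z \<in> {(u, v) \<in> pth_powers p \<times> pth_powers p. (u - v) mod int (p ^ 2) = t}"
      "z' \<in> {(u, v) \<in> pth_powers p \<times> pth_powers p. (u - v) mod int (p ^ 2) = t}" "fst z = fst z'"
    obtain u v v' where uv: "z = (u, v)" "z' = (u, v')" using z(3) by (cases z; cases z') auto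
    have "[u - v = u - v'] (mod int (p ^ 2))" using z uv by (simp add: cong_def)
    from cong_diff[OF cong_refl[of u] this] have "[v = v'] (mod int (p ^ 2))" by simp
    then have "v = v'" using z uv by (intro cong_eq_square) (auto simp: pth_powers_iff)
    then show "z = z'" by (simp add: uv)
  qed
qed (use finite_pth_powers in auto)

text \<open>Two members of the group that agree modulo \<open>p\<close> are equal, so a nonzero
  difference is never divisible by \<open>p\<close>.\<close>

lemma diff_count_eq_0:
  assumes "int p dvd t" "t \<noteq> 0"
  shows "diff_count (p ^ 2) (pth_powers p) t = 0"
proof -
  have "(u - v) mod int (p ^ 2) \<noteq> t" if "u \<in> pth_powers p" "v \<in> pth_powers p" for u v
  proof
    assume t: "(u - v) mod int (p ^ 2) = t"
    then have "[u - v = t] (mod int p)" by (intro cong_mod_p) (simp add: cong_def flip: t)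
    then have "int p dvd u - v" using assms(1) by (simp only: cong_dvd_iff)
    then have "[u = v] (mod int p)" by (simp only: cong_iff_dvd_diff)
    then have "u = v" using that by (intro pth_powers_eqI)
    with t assms(2) show False by simp
  qed
  then have "{(u, v) \<in> pth_powers p \<times> pth_powers p. (u - v) mod int (p ^ 2) = t} = {}" by auto
  then show ?thesis by (simp only: diff_count_def card.empty)
qed

text \<open>Reducing \<open>t\<close> first makes the chosen inverse depend only on the residue of
  \<open>t\<close>, which \<open>normalized_quotient_inj\<close> relies on.\<close>

definition inverse_mod_p :: "int \<Rightarrow> int" where
  "inverse_mod_p t = (t mod int p) ^ (p - 2)"

text \<open>The \<open>\<kappa>\<close> in \<open>t * s ^ p = 1 - p * \<kappa>\<close> with
  \<open>s\<close> inverse to \<open>t\<close> modulo \<open>p\<close>: the second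
  \<open>p\<close>-adic digit of \<open>t\<close> after scaling by a \<open>p\<close>-th
  power.\<close>

definition normalized_quotient :: "int \<Rightarrow> int" where
  "normalized_quotient t = (1 - t * inverse_mod_p t ^ p) div int p"

lemma inverse_mod_p:
  assumes "\<not> int p dvd t"
  shows "[t * inverse_mod_p t = 1] (mod int p)"
proof -
  have "coprime t (int p)" using assms prime_imp_coprime[OF prime_int_p] by (simp add: coprime_commute)
  have "[t * (t * inverse_mod_p t) = t * (t * t ^ (p - 2))] (mod int p)"
    unfolding inverse_mod_p_def by (intro cong_mult cong_refl cong_pow) simp
  also have "t * (t * t ^ (p - 2)) = t ^ p"
  proof -
    obtain q where "p = Suc (Suc q)" using p_gt_1 by (auto simp: less_eq_Suc_le dest!: le_Suc_ex)
    then show ?thesis by simp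
  qed
  also have "[t ^ p = t * 1] (mod int p)" using Fermat_little_int[OF prime_p] by simp
  finally show ?thesis using \<open>coprime t (int p)\<close> by (simp only: cong_mult_lcancel)
qed

lemma normalized_quotient:
  assumes "\<not> int p dvd t"
  shows "int p * normalized_quotient t = 1 - t * inverse_mod_p t ^ p"
proof -
  have "[t * inverse_mod_p t ^ p = t * inverse_mod_p t] (mod int p)"
    by (intro cong_mult cong_refl Fermat_little_int prime_p)
  then have "[t * inverse_mod_p t ^ p = 1] (mod int p)" using inverse_mod_p[OF assms] by (rule cong_trans)
  then have "int p dvd 1 - t * inverse_mod_p t ^ p" by (simp add: cong_iff_dvd_diff dvd_diff_commute)
  then show ?thesis by (simp add: normalized_quotient_def)
qed

lemma coprime_inverse_mod_p:
  assumes "\<not> int p dvd t"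
  shows "coprime (inverse_mod_p t) (int p)"
proof -
  have "\<not> int p dvd inverse_mod_p t"
  proof
    assume "int p dvd inverse_mod_p t"
    then have "int p dvd t * inverse_mod_p t" by simp
    then have "int p dvd 1" using inverse_mod_p[OF assms] by (simp only: cong_dvd_iff)
    then show False using p_gt_1 by simp
  qed
  then have "coprime (int p) (inverse_mod_p t)" by (rule prime_imp_coprime[OF prime_int_p])
  then show ?thesis by (subst coprime_commute)
qed

text \<open>Equal residues give the same \<open>s\<close>, so \<open>p ^ 2\<close> divides
  \<open>(t' - t) * s ^ p\<close>, and \<open>s\<close> is a unit.\<close>

lemma normalized_quotient_inj:
  assumes "\<not> int p dvd t" "\<not> int p dvd t'" "t \<in> {0..<int (p ^ 2)}" "t' \<in> {0..<int (p ^ 2)}"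
    and "t mod int p = t' mod int p" "[normalized_quotient t = normalized_quotient t'] (mod int p)"
  shows "t = t'"
proof -
  have s: "inverse_mod_p t' = inverse_mod_p t" using assms(5) by (simp add: inverse_mod_p_def)
  have "int p * int p dvd int p * (normalized_quotient t - normalized_quotient t')"
    using assms(6) by (intro mult_dvd_mono) (simp_all add: cong_iff_dvd_diff)
  also have "\<dots> = t' * inverse_mod_p t ^ p - t * inverse_mod_p t ^ p"
    using normalized_quotient[OF assms(1)] normalized_quotient[OF assms(2)] s by (simp add: right_diff_distrib)
  finally have "[t' * inverse_mod_p t ^ p = t * inverse_mod_p t ^ p] (mod int (p ^ 2))"
    by (simp add: cong_iff_dvd_diff power2_eq_square)
  moreover have "coprime (inverse_mod_p t ^ p) (int (p ^ 2))"
    using coprime_inverse_mod_p[OF assms(1)] by simp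
  ultimately have "[t' = t] (mod int (p ^ 2))" by (simp only: cong_mult_rcancel)
  then show ?thesis using assms(3,4) by (intro cong_eq_square) (auto simp: cong_sym)
qed

text \<open>Dividing \<open>u - v \<equiv> t\<close> by the \<open>p\<close>-th power \<open>s ^ p \<equiv> t\<close> turns it into
  \<open>m ^ p - (m - 1) ^ p \<equiv> 1 - p \<kappa>\<close> modulo \<open>p\<^sup>2\<close> with \<open>m \<equiv> u / s\<close> modulo \<open>p\<close>.\<close>

lemma diff_count_le_card_trunc_log_fiber:
  assumes t: "\<not> int p dvd t" and p: "p = CHAR('a::finite_field)" "odd p"
  shows "diff_count (p ^ 2) (pth_powers p) t \<le> card (trunc_log_fiber (of_int (normalized_quotient t) :: 'a))"
  unfolding diff_count_def
proof (rule card_inj_on_le[of "\<lambda>z. of_int (fst z * inverse_mod_p t)"])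
  define s where "s = inverse_mod_p t"
  let ?D = "{(u, v) \<in> pth_powers p \<times> pth_powers p. (u - v) mod int (p ^ 2) = t}"
  have ts: "[t * s = 1] (mod int p)" unfolding s_def by (rule inverse_mod_p[OF t])
  have cop: "coprime s (int p)" unfolding s_def by (rule coprime_inverse_mod_p[OF t])
  have eq_iff: "of_int x = (of_int y :: 'a) \<longleftrightarrow> [x = y] (mod int p)" for x y
    by (simp add: of_int_eq_iff_cong_CHAR p(1))
  show "inj_on (\<lambda>z. of_int (fst z * inverse_mod_p t) :: 'a) ?D"
  proof (rule inj_onI)
    fix z z' assume z: "z \<in> ?D" "z' \<in> ?D"
      and zz: "of_int (fst z * inverse_mod_p t) = (of_int (fst z' * inverse_mod_p t) :: 'a)"
    obtain u v u' v' where uv: "z = (u, v)" "z' = (u', v')" by (cases z; cases z') auto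
    have "of_int (u * s) = (of_int (u' * s) :: 'a)" using zz by (simp only: uv s_def fst_conv)
    then have "[u = u'] (mod int p)" unfolding eq_iff using cop by (simp only: cong_mult_rcancel)
    then have u: "u = u'" using z uv by (intro pth_powers_eqI) auto
    have "[u - v = u - v'] (mod int (p ^ 2))" using z uv u by (simp add: cong_def)
    from cong_diff[OF cong_refl[of u] this] have "[v = v'] (mod int (p ^ 2))" by simp
    then have "v = v'" using z uv by (intro cong_eq_square) (auto simp: pth_powers_iff)
    then show "z = z'" by (simp add: uv u)
  qed
  show "(\<lambda>z. of_int (fst z * inverse_mod_p t) :: 'a) ` ?D \<subseteq> trunc_log_fiber (of_int (normalized_quotient t))"
  proof (rule image_subsetI)
    fix z assume z: "z \<in> ?D"
    obtain u v where uv: "z = (u, v)" by (cases z)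
    with z have u: "u \<in> pth_powers p" and v: "v \<in> pth_powers p" and uvt: "(u - v) mod int (p ^ 2) = t" by auto
    have cong2: "[u - v = t] (mod int (p ^ 2))" by (simp add: cong_def flip: uvt)
    define m where "m = u * s"
    \<comment> \<open>Multiply \<open>u - v \<equiv> t\<close> by the inverse \<open>s\<close> of
      \<open>t\<close>.\<close>
    have m_v: "[m - 1 = v * s] (mod int p)"
    proof -
      have "[(u - v) * s = t * s] (mod int p)" by (intro cong_mult cong_mod_p cong2 cong_refl)
      then have "[(u - v) * s = 1] (mod int p)" using ts by (rule cong_trans)
      then have "[v * s + (u - v) * s = v * s + 1] (mod int p)" by (intro cong_add cong_refl)
      then have "[m = v * s + 1] (mod int p)" by (simp add: m_def algebra_simps)
      from cong_diff[OF this cong_refl[of 1]] show ?thesis by simp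
    qed
    have nz: "\<not> int p dvd w * s" if "w \<in> pth_powers p" for w
      using that cop by (simp add: pth_powers_iff coprime_dvd_mult_left_iff coprime_commute)
    have "(of_int m :: 'a) ^ p = of_int m"
      unfolding of_int_power[symmetric] eq_iff by (rule Fermat_little_int[OF prime_p])
    moreover have "of_int m \<noteq> (0 :: 'a)"
      using nz[OF u] eq_iff[of m 0] by (simp add: m_def cong_0_iff)
    moreover have "of_int m \<noteq> (1 :: 'a)"
    proof
      assume "of_int m = (1 :: 'a)"
      then have "[m = 1] (mod int p)" using eq_iff[of m 1] by simp
      then have "int p dvd m - 1" by (simp add: cong_iff_dvd_diff)
      then have "int p dvd v * s" using m_v by (simp only: cong_dvd_iff)
      then show False using nz[OF v] by simp
    qed
    moreover have "poly trunc_log (of_int m) = (of_int (normalized_quotient t) :: 'a)"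
    proof -
      obtain q where q: "int p * q = 1 + (m - 1) ^ p - m ^ p" "of_int q = poly trunc_log (of_int m :: 'a)"
        using of_int_Fermat_quotient_eq_trunc_log[where 'a = 'a, of m] p by auto
      \<comment> \<open>Members of the group are fixed by \<open>w \<mapsto> w ^ p\<close> modulo
        \<open>p ^ 2\<close>, so only \<open>s\<close> picks up the exponent.\<close>
      have pw: "[(w * s) ^ p = w * s ^ p] (mod int (p ^ 2))" if "w \<in> pth_powers p" for w
        unfolding power_mult_distrib using that by (intro cong_mult cong_refl) (simp add: pth_powers_iff)
      have "[(m - 1) ^ p = (v * s) ^ p] (mod int (p ^ 2))" by (rule cong_prime_power_lift[OF m_v])
      then have "[(m - 1) ^ p = v * s ^ p] (mod int (p ^ 2))" using pw[OF v] by (rule cong_trans)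
      then have "[1 + (m - 1) ^ p - m ^ p = 1 + v * s ^ p - u * s ^ p] (mod int (p ^ 2))"
        using pw[OF u] unfolding m_def by (intro cong_diff cong_add cong_refl)
      also have "1 + v * s ^ p - u * s ^ p = 1 - (u - v) * s ^ p" by (simp add: algebra_simps)
      also have "[\<dots> = 1 - t * s ^ p] (mod int (p ^ 2))"
        by (intro cong_diff cong_mult cong2 cong_refl)
      also have "1 - t * s ^ p = int p * normalized_quotient t"
        unfolding s_def by (rule normalized_quotient[OF t, symmetric])
      finally have "[int p * q = int p * normalized_quotient t] (mod int (p ^ 2))" unfolding q(1) .
      then have "int p * int p dvd int p * (q - normalized_quotient t)"
        by (simp add: cong_iff_dvd_diff power2_eq_square right_diff_distrib)
      then have "[q = normalized_quotient t] (mod int p)"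
        using p_gt_1 by (simp add: cong_iff_dvd_diff)
      then show ?thesis unfolding q(2)[symmetric] eq_iff .
    qed
    ultimately show "(of_int (fst z * inverse_mod_p t) :: 'a) \<in> trunc_log_fiber (of_int (normalized_quotient t))"
      unfolding uv fst_conv s_def[symmetric] m_def[symmetric] trunc_log_fiber_def p(1)[symmetric] mem_Collect_eq
      by (intro conjI)
  qed
qed (simp add: trunc_log_fiber_def)

text \<open>The difference 0 contributes at most \<open>p ^ 3\<close>, the other multiples of
  \<open>p\<close> nothing. The remaining \<open>t\<close> inject into pairs of a residue modulo
  \<open>p\<close> and a field element, so each fiber is counted at most \<open>p\<close>
  times.\<close>

lemma additive_energy3_pth_powers_le:
  assumes p: "p = CHAR('a::finite_field)" "odd p"
  shows "additive_energy3 (p ^ 2) (pth_powers p)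
     \<le> p ^ 3 + p * (\<Sum>k\<in>UNIV. card (trunc_log_fiber (k :: 'a)) ^ 3)"
proof -
  define Z where "Z = {0..<int (p ^ 2)}"
  define r where "r = diff_count (p ^ 2) (pth_powers p)"
  define \<kappa> where "\<kappa> t = (of_int (normalized_quotient t) :: 'a)" for t
  define N where "N k = card (trunc_log_fiber (k :: 'a))" for k
  let ?U = "{t \<in> Z. \<not> int p dvd t}"
  have "additive_energy3 (p ^ 2) (pth_powers p) = (\<Sum>t\<in>Z. r t ^ 3)"
    by (simp add: additive_energy3_def Z_def r_def)
  also have "\<dots> = (\<Sum>t\<in>insert 0 ?U. r t ^ 3)"
    using p_gt_1 by (intro sum.mono_neutral_right) (auto simp: Z_def r_def diff_count_eq_0)
  also have "\<dots> = r 0 ^ 3 + (\<Sum>t\<in>?U. r t ^ 3)"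
  proof (rule sum.insert)
    show "finite ?U" by (rule finite_subset[of _ Z]) (auto simp: Z_def)
  qed simp
  also have "\<dots> \<le> p ^ 3 + (\<Sum>t\<in>?U. N (\<kappa> t) ^ 3)"
  proof (intro add_mono sum_mono power_mono)
    show "r 0 \<le> p" using diff_count_le_card card_pth_powers_le order.trans unfolding r_def by blast
    show "r t \<le> N (\<kappa> t)" if "t \<in> ?U" for t
      using that diff_count_le_card_trunc_log_fiber[OF _ p] by (simp add: r_def N_def \<kappa>_def)
  qed simp_all
  also have "(\<Sum>t\<in>?U. N (\<kappa> t) ^ 3) = (\<Sum>(s, k)\<in>(\<lambda>t. (t mod int p, \<kappa> t)) ` ?U. N k ^ 3)"
  proof -
    have "inj_on (\<lambda>t. (t mod int p, \<kappa> t)) ?U"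
    proof (rule inj_onI)
      fix t t' assume t: "t \<in> ?U" "t' \<in> ?U" "(t mod int p, \<kappa> t) = (t' mod int p, \<kappa> t')"
      then have "[normalized_quotient t = normalized_quotient t'] (mod int p)"
        unfolding \<kappa>_def prod.inject of_int_eq_iff_cong_CHAR p(1)[symmetric] by blast
      with t show "t = t'" unfolding Z_def prod.inject by (blast intro: normalized_quotient_inj)
    qed
    from sum.reindex[OF this, of "\<lambda>(s, k). N k ^ 3"] show ?thesis by (simp only: o_def prod.case)
  qed
  also have "\<dots> \<le> (\<Sum>(s, k)\<in>{0..<int p} \<times> UNIV. N k ^ 3)"
    using p_gt_1 by (intro sum_mono2) auto
  also have "\<dots> = p * (\<Sum>k\<in>UNIV. N k ^ 3)"
    by (simp flip: sum.cartesian_product)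
  finally show ?thesis by (simp add: N_def)
qed

end

section \<open>Heilbronn's sum\<close>

text \<open>In \<open>221185 = 221184 + 1\<close>, the first summand comes from the fibers and the
  second from the difference 0.\<close>

definition energy_bound :: "nat \<Rightarrow> bool" where
  "energy_bound p \<longleftrightarrow>
     real (additive_energy3 (p ^ 2) (pth_powers p)) \<le> 221185 * real p ^ 3 * log 2 (real p)"

lemma energy_bound_CARD:
  assumes "odd CARD('a::prime_card)"
  shows "energy_bound CARD('a)"
proof -
  define p where "p = CARD('a)"
  have p: "prime p" "p = CHAR('a mod_ring)" using prime_card[where 'a = 'a] by (simp_all add: p_def)
  define \<Sigma> where "\<Sigma> = (\<Sum>k\<in>UNIV. card (trunc_log_fiber (k :: 'a mod_ring)) ^ 3)"
  have L: "1 \<le> log 2 (real p)" using prime_ge_2_nat[OF p(1)] by simp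
  have "additive_energy3 (p ^ 2) (pth_powers p) \<le> p ^ 3 + p * \<Sigma>"
    unfolding \<Sigma>_def using assms p by (intro additive_energy3_pth_powers_le) (simp_all add: p_def)
  then have "real (additive_energy3 (p ^ 2) (pth_powers p)) \<le> real p ^ 3 * 1 + real p * real \<Sigma>"
    by (simp flip: of_nat_power of_nat_mult of_nat_add)
  also have "\<dots> \<le> real p ^ 3 * log 2 (real p) + real p * (221184 * real p ^ 2 * log 2 (real p))"
    using L sum_card_trunc_log_fiber_cube_le[where 'a = "'a mod_ring"]
    unfolding \<Sigma>_def p(2)[symmetric] by (intro add_mono mult_left_mono) auto
  also have "\<dots> = 221185 * real p ^ 3 * log 2 (real p)"
    by (simp add: power2_eq_square power3_eq_cube)
  finally show ?thesis by (simp add: energy_bound_def p_def)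
qed

text \<open>The field with \<open>p\<close> elements is only available for types of cardinality \<open>p\<close>, and a type
  cannot depend on \<open>p\<close>. It suffices to have such a type for one single prime, chosen as a
  counterexample if there is any.\<close>

definition critical_prime :: nat where
  "critical_prime = (if \<exists>p. prime p \<and> odd p \<and> \<not> energy_bound p
     then SOME p. prime p \<and> odd p \<and> \<not> energy_bound p else 3)"

lemma prime_critical_prime: "prime critical_prime"
  and odd_critical_prime: "odd critical_prime"
  and critical_prime: "\<lbrakk>prime p; odd p; \<not> energy_bound p\<rbrakk> \<Longrightarrow> \<not> energy_bound critical_prime"
proof -
  have "prime critical_prime \<and> odd critical_prime
      \<and> ((\<exists>p. prime p \<and> odd p \<and> \<not> energy_bound p) \<longrightarrow> \<not> energy_bound critical_prime)"
  proof (cases "\<exists>p. prime p \<and> odd p \<and> \<not> energy_bound p")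
    case True
    from someI_ex[OF True] True show ?thesis by (simp add: critical_prime_def)
  next
    case False
    \<comment> \<open>The default 3 is an odd prime, so the first two claims hold in this case as
      well.\<close>
    then have *: "critical_prime = 3" unfolding critical_prime_def by (rule if_not_P)
    have "prime (3 :: nat)" by simp
    with False show ?thesis unfolding * by auto
  qed
  then show "prime critical_prime" "odd critical_prime"
    "\<lbrakk>prime p; odd p; \<not> energy_bound p\<rbrakk> \<Longrightarrow> \<not> energy_bound critical_prime" by blast+
qed

typedef critical_index = "{..<critical_prime}"
  using prime_gt_0_nat[OF prime_critical_prime] by auto

lemma CARD_critical_index: "CARD(critical_index) = critical_prime"
  using type_definition.card[OF type_definition_critical_index] by simp

instance critical_index :: prime_card
  by standard (simp add: CARD_critical_index prime_critical_prime)

text \<open>Any odd prime violating the bound would make \<open>critical_prime\<close> violate it,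
  but the bound holds for the cardinality of \<open>critical_index\<close>.\<close>

lemma energy_bound: "prime p \<Longrightarrow> odd p \<Longrightarrow> energy_bound p"
  using critical_prime energy_bound_CARD[where 'a = critical_index] odd_critical_prime
  by (auto simp: CARD_critical_index)

lemma norm_heilbronn_sum_le:
  assumes p: "prime p" "odd p" and a: "\<not> int p dvd a"
  shows "norm (heilbronn_sum p a) \<le> 1 + 8 * (real p powr (5 / 6) * log 2 (real p) powr (1 / 6))"
proof -
  define S where "S = (\<Sum>u\<in>pth_powers p. add_char (p ^ 2) (a * u))"
  define B where "B = real p powr (5 / 6) * log 2 (real p) powr (1 / 6)"
  have p0: "real p > 0" "log 2 (real p) > 0" using prime_gt_1_nat[OF p(1)] by auto
  have "(x powr (1 / 6)) ^ 6 = x" if "x > 0" for x :: real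
    using that by (simp add: powr_power)
  moreover have "(real p powr (5 / 6)) ^ 6 = real p ^ 5"
    using p0 powr_realpow[of "real p" 5] by (simp add: powr_power)
  ultimately have B6: "B ^ 6 = real p ^ 5 * log 2 (real p)" using p0(2) by (simp only: B_def power_mult_distrib)
  have "norm S ^ 6 \<le> real p ^ 2 * real (additive_energy3 (p ^ 2) (pth_powers p))"
    using norm_sum_pth_powers_power6_le[OF p(1) a] by (simp add: S_def)
  also have "\<dots> \<le> real p ^ 2 * (221185 * real p ^ 3 * log 2 (real p))"
    using energy_bound[OF p] by (intro mult_left_mono) (simp_all add: energy_bound_def)
  also have "\<dots> = 221185 * B ^ 6"
    unfolding B6 by (simp flip: power_add)
  \<comment> \<open>\<open>8 ^ 6 = 262144\<close> exceeds 221185.\<close>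
  also have "\<dots> \<le> (8 * B) ^ 6" by (simp add: power_mult_distrib)
  \<comment> \<open>The root rule is stated for the exponent \<open>Suc n\<close>, hence 5 for a
    sixth root.\<close>
  finally have "norm S \<le> 8 * B" by (rule power_le_imp_le_base[of _ 5, simplified]) (simp add: B_def)
  moreover have "norm (heilbronn_sum p a) \<le> 1 + norm S"
    using heilbronn_sum_eq[OF p(1), of a] norm_triangle_ineq[of 1 S] by (simp add: S_def)
  ultimately show ?thesis by (simp add: B_def)
qed

theorem theorem2:
  "\<exists>c::real. c > 0 \<and>
     (\<forall>(p::nat) (a::int). prime p \<longrightarrow> \<not> [a = 0] (mod int p) \<longrightarrow>
        norm (heilbronn_sum p a) \<le> c * (real p powr (31 / 36) * log 2 (real p) powr (1 / 6)))"
\<comment> \<open>9 = 8 + 1: the separate term 1 is absorbed by \<open>B \<ge> 1\<close>.\<close>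
proof (intro exI[of _ 9] conjI allI impI)
  fix p :: nat and a :: int
  assume p: "prime p" and "\<not> [a = 0] (mod int p)"
  then have a: "\<not> int p dvd a" by (simp add: cong_0_iff)
  define B where "B = real p powr (31 / 36) * log 2 (real p) powr (1 / 6)"
  have p2: "real p \<ge> 2" "log 2 (real p) \<ge> 1" using prime_ge_2_nat[OF p] by simp_all
  then have "1 * 1 \<le> B" unfolding B_def by (intro mult_mono ge_one_powr_ge_zero) auto
  moreover have "norm (heilbronn_sum p a) \<le> 1 + 8 * B"
  proof (cases "odd p")
    case True
    have "real p powr (5 / 6) * log 2 (real p) powr (1 / 6) \<le> B"
      using p2 unfolding B_def by (intro mult_right_mono powr_mono) auto
    with norm_heilbronn_sum_le[OF p True a] show ?thesis by linarith
  next
    case False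
    \<comment> \<open>For the even prime the trivial bound by the number of terms suffices.\<close>
    then have "p = 2" using prime_odd_nat[OF p] prime_ge_2_nat[OF p] by linarith
    have "norm (heilbronn_sum p a) \<le> (\<Sum>n = 1..p. 1)"
      unfolding heilbronn_sum_def by (intro sum_norm_le) (simp add: norm_exp_eq_Re)
    also have "\<dots> = 2" by (simp add: \<open>p = 2\<close>)
    finally show ?thesis using \<open>1 * 1 \<le> B\<close> by linarith
  qed
  ultimately show "norm (heilbronn_sum p a) \<le> 9 * (real p powr (31 / 36) * log 2 (real p) powr (1 / 6))"
    unfolding B_def by linarith
qed simp

end
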